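(* Let $H\in[\frac12,\frac34)$ be known, let $c>0$, and let $u^c$ be the mild solution of the one-dimensional stochastic wave equation $\partial_t^2u=c^2\partial_x^2u+\dot W^H$ with zero initial conditions driven by the fractional-white noise $W^H$. Fix $x\in\mathbb R$. Then, based on the observations $u^c(\frac iN,x)$, $i=1,\dots,N$ (and $u^c(0,x)=0$), $$\hat c_N=\frac14\cdot\frac{1}{N^{2H-1}\sum_{i=0}^{N-1}\left(u^c\left(\frac{i+1}{N},x\right)-u^c\left(\frac iN,x\right)\right)^2}$$ is a strongly consistent and asymptotically normal estimator of $c$ (as $N\to\infty$).
   Context: The equation is considered for $t\ge0$, $x\in\mathbb R$, with $u(0,x)=0$ and $\partial_tu(0,x)=0$. The noise $W^H$ is centred Gaussian, fractional in time with Hurst parameter $H$ and white in space: the Wiener integrals of deterministic functions $f,g$ on $[0,\infty)\times\mathbb R$ are jointly centred Gaussian with $$\mathbb E\Big[\int f\,dW^H\int g\,dW^H\Big]=H(2H-1)\int_0^\infty\!\int_0^\infty\!\int_{\mathbb R}f(r,y)g(v,y)|r-v|^{2H-2}\,dy\,dv\,dr\quad\text{if } H>\tfrac12,$$ and $=\int_0^\infty\int_{\mathbb R}f(r,y)g(r,y)\,dy\,dr$ if $H=\frac12$. The mild solution is the centred Gaussian field (first argument time, second space) $$u^c(t,x)=\frac1{2c}\int_0^t\int_{\mathbb R}\mathbf 1_{\{|y-x|\le c(t-s)\}}\,W^H(ds,dy).$$ An estimator $\hat\theta_N$ of $\theta$ is strongly consistent if $\hat\theta_N\to\theta$ almost surely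 as $N\to\infty$; it is asymptotically normal if there are deterministic $a_N\to\infty$ (possibly depending on the true parameter) such that $a_N(\hat\theta_N-\theta)$ converges in distribution to a normal law with strictly positive variance. *)

theory Defs
  imports "HOL-Probability.Probability"
begin

text \<open>Degenerate (almost surely zero) variables count as centred Gaussian.\<close>

definition centred_gaussian :: "'a measure \<Rightarrow> ('a \<Rightarrow> real) \<Rightarrow> bool" where
  "centred_gaussian M X \<longleftrightarrow>
     X \<in> borel_measurable M \<and>
     ((AE \<omega> in M. X \<omega> = 0) \<or> (\<exists>\<sigma>>0. distributed M lborel X (normal_density 0 \<sigma>)))"

definition jointly_centred_gaussian ::
    "'a measure \<Rightarrow> 'i set \<Rightarrow> ('i \<Rightarrow> 'a \<Rightarrow> real) \<Rightarrow> bool" where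
  "jointly_centred_gaussian M I X \<longleftrightarrow>
     (\<forall>J a. finite J \<and> J \<subseteq> I \<longrightarrow> centred_gaussian M (\<lambda>\<omega>. \<Sum>j\<in>J. a j * X j \<omega>))"

text \<open>
  Integrands are functions of (time, space). They are total functions on the plane, but only
  their values on \<open>{0..} \<times> UNIV\<close> matter. The admissible integrands are those for which the
  integral defining the variance converges absolutely. Absolute convergence of
  \<open>noise_cov H f g\<close> for two admissible integrands then follows from the Cauchy-Schwarz inequality.
  At \<open>r = v\<close> the kernel takes the value \<open>0 powr (2 * H - 2) = 0\<close>, on a null set.
\<close>

definition noise_integrands :: "real \<Rightarrow> (real \<times> real \<Rightarrow> real) set" where
  "noise_integrands H = {f \<in> borel_measurable borel.
     if H = 1/2
     then set_integrable lborel ({0..} \<times> UNIV) (\<lambda>(r, y). f (r, y) * f (r, y))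
     else set_integrable lborel ({0..} \<times> {0..} \<times> UNIV)
            (\<lambda>(r, v, y). f (r, y) * f (v, y) * \<bar>r - v\<bar> powr (2 * H - 2))}"

definition noise_cov :: "real \<Rightarrow> (real \<times> real \<Rightarrow> real) \<Rightarrow> (real \<times> real \<Rightarrow> real) \<Rightarrow> real" where
  "noise_cov H f g =
     (if H = 1/2
      then (LINT r:{0..}|lborel. LINT y|lborel. f (r, y) * g (r, y))
      else H * (2 * H - 1) *
           (LINT r:{0..}|lborel. LINT v:{0..}|lborel. LINT y|lborel.
              f (r, y) * g (v, y) * \<bar>r - v\<bar> powr (2 * H - 2)))"

text \<open>\<open>W f\<close> is the Wiener integral of \<open>f\<close> with respect to the noise. It is
  constrained only on admissible integrands; its linearity up to null sets follows from the
  covariance formula.\<close>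

definition fractional_white_noise ::
    "'a measure \<Rightarrow> real \<Rightarrow> ((real \<times> real \<Rightarrow> real) \<Rightarrow> 'a \<Rightarrow> real) \<Rightarrow> bool" where
  "fractional_white_noise M H W \<longleftrightarrow>
     jointly_centred_gaussian M (noise_integrands H) W \<and>
     (\<forall>f\<in>noise_integrands H. \<forall>g\<in>noise_integrands H.
        (LINT \<omega>|M. W f \<omega> * W g \<omega>) = noise_cov H f g)"

definition backward_cone :: "real \<Rightarrow> real \<Rightarrow> real \<Rightarrow> (real \<times> real) set" where
  "backward_cone c t x = {(s, y). 0 \<le> s \<and> s \<le> t \<and> \<bar>y - x\<bar> \<le> c * (t - s)}"

text \<open>Wiener integrals are determined only up to null sets, so the mild solution is any
  random field that is a version of the stochastic convolution with the wave kernel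
  \<open>(1 / (2 * c)) * indicator {y. \<bar>y - x\<bar> \<le> c * (t - s)}\<close>.\<close>

definition mild_wave_solution ::
    "'a measure \<Rightarrow> ((real \<times> real \<Rightarrow> real) \<Rightarrow> 'a \<Rightarrow> real) \<Rightarrow> real \<Rightarrow>
     (real \<Rightarrow> real \<Rightarrow> 'a \<Rightarrow> real) \<Rightarrow> bool" where
  "mild_wave_solution M W c u \<longleftrightarrow>
     (\<forall>t\<ge>0. \<forall>x. u t x \<in> borel_measurable M \<and>
        (AE \<omega> in M. u t x \<omega> = 1 / (2 * c) * W (indicat_real (backward_cone c t x)) \<omega>))"

text \<open>The argument \<open>d\<close> is the vector of observations, \<open>d i\<close> being the value observed at
  time \<open>i / N\<close> for \<open>i = 0, \<dots>, N\<close>. If all increments vanish, the value is \<open>0\<close> by the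
  convention \<open>1 / 0 = 0\<close>.\<close>

definition speed_estimator :: "real \<Rightarrow> nat \<Rightarrow> (nat \<Rightarrow> real) \<Rightarrow> real" where
  "speed_estimator H N d =
     1/4 * (1 / (real N powr (2 * H - 1) * (\<Sum>i<N. (d (i + 1) - d i)\<^sup>2)))"

definition strongly_consistent ::
    "'a measure \<Rightarrow> (nat \<Rightarrow> 'a \<Rightarrow> real) \<Rightarrow> real \<Rightarrow> bool" where
  "strongly_consistent M est \<theta> \<longleftrightarrow>
     (\<forall>N. est N \<in> borel_measurable M) \<and> (AE \<omega> in M. (\<lambda>N. est N \<omega>) \<longlonglongrightarrow> \<theta>)"

definition asymptotically_normal ::
    "'a measure \<Rightarrow> (nat \<Rightarrow> 'a \<Rightarrow> real) \<Rightarrow> real \<Rightarrow> bool" where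
  "asymptotically_normal M est \<theta> \<longleftrightarrow>
     (\<forall>N. est N \<in> borel_measurable M) \<and>
     (\<exists>a :: nat \<Rightarrow> real. filterlim a at_top sequentially \<and>
        (\<exists>\<mu> \<sigma>. \<sigma> > 0 \<and>
           weak_conv_m (\<lambda>N. distr M borel (\<lambda>\<omega>. a N * (est N \<omega> - \<theta>)))
                       (density lborel (normal_density \<mu> \<sigma>))))"

end

(*
  At fixed x the increments D i = u ((i + 1) / N) x - u (i / N) x are jointly Gaussian. Integrating the
  noise covariance over space last gives, with p = 2 H,
    E (u s x * u t x) = ((t^(p+1) + s^(p+1) - |t - s|^(p+1)) / (p + 1) - min s t * |t - s|^p) / (4 c).
  Hence X N = N^(p-1) * (sum of the (D i)^2) has mean 1 / (4 c) + O(1 / N). The covariances of the D i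
  are nonnegative, so the row sums of the covariance matrix S telescope and are O(1 / N).

  Gaussian integration by parts gives a recursion that expresses the moments of the centred
  quadratic form X N - E (X N) by the traces tr (S^r). The row sum bound makes the normalised traces
  with r >= 3 vanish in the limit because p < 3/2, so the normalised moments converge to those of the
  standard normal law. Expanding the characteristic function turns this into a central limit theorem;
  the fourth moments are O(N^(2p-4)), which is summable, so X N converges almost surely. Both facts
  carry over to the estimator 1 / (4 * X N), the second one by a Slutsky argument.
*)
theory Submission
  imports Defs
begin

subsection \<open>Random variables with all moments\<close>

text \<open>Slicing the backward cone at a fixed \<open>y\<close> leaves the time interval from 0 to
  \<open>t - |y - x| / c\<close>, so the solution is formally an integral over \<open>y\<close> of
  independent fractional Brownian motions read at shifted times. An increment over a step
  \<open>h\<close> at time \<open>t\<close> has variance about \<open>2 t h^p / (4 c)\<close>; the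
  integral of \<open>2 t\<close> over the unit interval is 1, whence the factor \<open>1/4\<close>
  of the estimator.

  No exact asymptotics of the variance of \<open>X N\<close> is used. The sum is divided by its own
  standard deviation \<open>s N\<close>, which the diagonal of \<open>S\<close> keeps above a
  multiple of \<open>N^(-1/2)\<close> and the row sums keep below a multiple of
  \<open>N^(p/2-1)\<close>. Relative to \<open>s N\<close>, the operator norm of
  \<open>N^(p-1) S\<close> is then \<open>O(N^(p-3/2))\<close>; the same threshold
  \<open>p < 3/2\<close> governs this and the summability of the fourth moments.

  Joint Gaussianity is available only as Gaussianity of all linear combinations, degenerate ones
  included. So integration by parts is not read off a joint density: the one-dimensional moment
  identity is differentiated along \<open>Y + e * X\<close>, which is harmless because moments are
  polynomials in \<open>e\<close>.\<close>

context prob_space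
begin

text \<open>Unlike integrability, this property is stable under products, so every polynomial in
  Gaussian variables has it. It settles the integrability questions in the moment
  computations.\<close>

definition all_moments :: "('a \<Rightarrow> real) \<Rightarrow> bool" where
  "all_moments f \<longleftrightarrow> f \<in> borel_measurable M \<and> (\<forall>n. integrable M (\<lambda>\<omega>. \<bar>f \<omega>\<bar> ^ n))"

lemma all_moments_measurable: "all_moments f \<Longrightarrow> f \<in> borel_measurable M"
  by (simp add: all_moments_def)

lemma all_moments_integrable:
  assumes "all_moments f"
  shows "integrable M f"
proof -
  have "integrable M (\<lambda>\<omega>. \<bar>f \<omega>\<bar> ^ 1)"
    using assms unfolding all_moments_def by blast
  then have "integrable M (\<lambda>\<omega>. \<bar>f \<omega>\<bar>)"
    by simp
  then show ?thesis
    using assms integrable_abs_cancel all_moments_measurable by blast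
qed

lemma all_moments_const: "all_moments (\<lambda>_. c)"
  by (simp add: all_moments_def)

lemma all_moments_add:
  assumes "all_moments f" "all_moments g"
  shows "all_moments (\<lambda>\<omega>. f \<omega> + g \<omega>)"
  unfolding all_moments_def
proof (intro conjI allI)
  show m: "(\<lambda>\<omega>. f \<omega> + g \<omega>) \<in> borel_measurable M"
    using assms by (auto simp: all_moments_def)
  fix n
  show "integrable M (\<lambda>\<omega>. \<bar>f \<omega> + g \<omega>\<bar> ^ n)"
  proof (rule Bochner_Integration.integrable_bound)
    show "integrable M (\<lambda>\<omega>. 2 ^ n * (\<bar>f \<omega>\<bar> ^ n + \<bar>g \<omega>\<bar> ^ n))"
      using assms by (auto simp: all_moments_def)
    show "(\<lambda>\<omega>. \<bar>f \<omega> + g \<omega>\<bar> ^ n) \<in> borel_measurable M"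
      using m by measurable
    have "\<bar>x + y\<bar> ^ n \<le> 2 ^ n * (\<bar>x\<bar> ^ n + \<bar>y\<bar> ^ n)" for x y :: real
    proof -
      have "\<bar>x + y\<bar> ^ n \<le> (2 * max \<bar>x\<bar> \<bar>y\<bar>) ^ n"
        by (rule power_mono) auto
      also have "\<dots> \<le> 2 ^ n * (\<bar>x\<bar> ^ n + \<bar>y\<bar> ^ n)"
        by (auto simp: power_mult_distrib max_def)
      finally show ?thesis .
    qed
    then show "AE \<omega> in M. norm (\<bar>f \<omega> + g \<omega>\<bar> ^ n) \<le> norm (2 ^ n * (\<bar>f \<omega>\<bar> ^ n + \<bar>g \<omega>\<bar> ^ n))"
      by auto
  qed
qed

lemma all_moments_mult:
  assumes "all_moments f" "all_moments g"
  shows "all_moments (\<lambda>\<omega>. f \<omega> * g \<omega>)"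
  unfolding all_moments_def
proof (intro conjI allI)
  show m: "(\<lambda>\<omega>. f \<omega> * g \<omega>) \<in> borel_measurable M"
    using assms by (auto simp: all_moments_def)
  fix n
  show "integrable M (\<lambda>\<omega>. \<bar>f \<omega> * g \<omega>\<bar> ^ n)"
  proof (rule Bochner_Integration.integrable_bound)
    show "integrable M (\<lambda>\<omega>. \<bar>f \<omega>\<bar> ^ (2 * n) + \<bar>g \<omega>\<bar> ^ (2 * n))"
      using assms unfolding all_moments_def by (intro Bochner_Integration.integrable_add) blast+
    show "(\<lambda>\<omega>. \<bar>f \<omega> * g \<omega>\<bar> ^ n) \<in> borel_measurable M"
      using m by measurable
    have "\<bar>x * y\<bar> ^ n \<le> \<bar>x\<bar> ^ (2 * n) + \<bar>y\<bar> ^ (2 * n)" for x y :: real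
    proof -
      have "2 * (\<bar>x\<bar> ^ n * \<bar>y\<bar> ^ n) \<le> (\<bar>x\<bar> ^ n)\<^sup>2 + (\<bar>y\<bar> ^ n)\<^sup>2"
        using sum_squares_bound[of "\<bar>x\<bar> ^ n" "\<bar>y\<bar> ^ n"] by (simp add: mult.assoc)
      then have "2 * (\<bar>x\<bar> ^ n * \<bar>y\<bar> ^ n) \<le> \<bar>x\<bar> ^ (2 * n) + \<bar>y\<bar> ^ (2 * n)"
        by (simp only: power_mult[symmetric] mult.commute[of n 2])
      moreover have "0 \<le> \<bar>x\<bar> ^ n * \<bar>y\<bar> ^ n" by simp
      ultimately show ?thesis
        unfolding abs_mult power_mult_distrib by linarith
    qed
    then show "AE \<omega> in M. norm (\<bar>f \<omega> * g \<omega>\<bar> ^ n) \<le> norm (\<bar>f \<omega>\<bar> ^ (2 * n) + \<bar>g \<omega>\<bar> ^ (2 * n))"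
      by auto
  qed
qed

lemma all_moments_cmult: "all_moments f \<Longrightarrow> all_moments (\<lambda>\<omega>. c * f \<omega>)"
  by (intro all_moments_mult all_moments_const)

lemma all_moments_abs: "all_moments f \<Longrightarrow> all_moments (\<lambda>\<omega>. \<bar>f \<omega>\<bar>)"
  unfolding all_moments_def by (auto intro: borel_measurable_abs)

lemma all_moments_power: "all_moments f \<Longrightarrow> all_moments (\<lambda>\<omega>. f \<omega> ^ n)"
  by (induction n) (auto intro: all_moments_mult all_moments_const)

lemma all_moments_sum: "(\<And>i. i \<in> I \<Longrightarrow> all_moments (f i)) \<Longrightarrow> all_moments (\<lambda>\<omega>. \<Sum>i\<in>I. f i \<omega>)"
  by (induction I rule: infinite_finite_induct) (auto intro: all_moments_add all_moments_const)

lemmas all_moments_intros = all_moments_const all_moments_add all_moments_mult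
  all_moments_cmult all_moments_abs all_moments_power all_moments_sum

text \<open>The recursion is written with the second moment in place of \<open>\<sigma>\<close>: it
  then also covers the degenerate case, and every term in it is a moment that can be differentiated
  along a perturbation.\<close>

lemma centred_gaussian_moments:
  assumes "centred_gaussian M X"
  shows "all_moments X" and "expectation X = 0"
    and "expectation (\<lambda>\<omega>. X \<omega> ^ (n + 2)) = real (n + 1) * expectation (\<lambda>\<omega>. (X \<omega>)\<^sup>2) * expectation (\<lambda>\<omega>. X \<omega> ^ n)"
proof -
  have X[measurable]: "X \<in> borel_measurable M"
    using assms by (simp add: centred_gaussian_def)
  have "all_moments X \<and> expectation X = 0 \<and>
    expectation (\<lambda>\<omega>. X \<omega> ^ (n + 2)) = real (n + 1) * expectation (\<lambda>\<omega>. (X \<omega>)\<^sup>2) * expectation (\<lambda>\<omega>. X \<omega> ^ n)"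
  proof (cases "AE \<omega> in M. X \<omega> = 0")
    case True
    have "expectation (\<lambda>\<omega>. X \<omega> ^ k) = expectation (\<lambda>\<omega>. 0 ^ k)" for k
      by (intro integral_cong_AE) (use True in auto)
    moreover have "integrable M (\<lambda>\<omega>. \<bar>X \<omega>\<bar> ^ k)" for k
      by (rule integrable_cong_AE[THEN iffD1, of "\<lambda>_. 0 ^ k"]) (use True in auto)
    moreover have "expectation X = expectation (\<lambda>\<omega>. 0)"
      by (intro integral_cong_AE) (use True in auto)
    moreover have "expectation (\<lambda>\<omega>. X \<omega> ^ (n + 2)) = 0" "expectation (\<lambda>\<omega>. (X \<omega>)\<^sup>2) = 0"
      using calculation(1)[of "n + 2"] calculation(1)[of 2] by simp_all
    ultimately show ?thesis
      by (simp add: all_moments_def)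
  next
    case False
    then obtain s where s: "s > 0" and D: "distributed M lborel X (normal_density 0 s)"
      using assms by (auto simp: centred_gaussian_def)
    define m where "m k = expectation (\<lambda>\<omega>. X \<omega> ^ k)" for k
    have I: "m k = (LINT x|lborel. normal_density 0 s x * x ^ k)" for k
      unfolding m_def by (rule distributed_integral[OF D, symmetric]) auto
    have even: "m (2 * k) = fact (2 * k) / ((2 / s\<^sup>2) ^ k * fact k)" for k
      using integral_normal_moment_even[OF s, of 0 k] I[of "2 * k"] by simp
    have odd: "m (2 * k + 1) = 0" for k
      using integral_normal_moment_odd[OF s, of 0 k] I[of "2 * k + 1"] by simp
    have A: "integrable M (\<lambda>\<omega>. \<bar>X \<omega>\<bar> ^ k)" for k
    proof (subst distributed_integrable[OF D, symmetric])
      show "(\<lambda>x::real. \<bar>x\<bar> ^ k) \<in> borel_measurable lborel" by measurable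
      show "0 \<le> normal_density 0 s x" for x by simp
      show "integrable lborel (\<lambda>x. normal_density 0 s x * \<bar>x\<bar> ^ k)"
        using integrable_normal_moment_abs[OF s, of 0 k] by simp
    qed
    have m2: "m 2 = s\<^sup>2"
      using even[of 1] s by (simp add: power2_eq_square)
    have "m (n + 2) = real (n + 1) * m 2 * m n"
    proof (cases "even n")
      case True
      then obtain k where k: "n = 2 * k" by (auto elim: evenE)
      have "m (n + 2) = fact (2 * k + 2) / ((2 / s\<^sup>2) ^ (k + 1) * fact (k + 1))"
        using even[of "k + 1"] by (simp add: k)
      also have "\<dots> = real (2 * k + 1) * s\<^sup>2 * (fact (2 * k) / ((2 / s\<^sup>2) ^ k * fact k))"
      proof -
        \<comment> \<open>The quotient of consecutive even moments, with \<open>K = k\<close>,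
          \<open>F = (2k)!\<close>, \<open>A = (2 / s^2)^k\<close>, \<open>G = k!\<close> and
          \<open>b = 2 / s^2\<close>.\<close>
        have aux: "(2 * (K + 1) * ((2 * K + 1) * F)) / ((b * A) * ((K + 1) * G)) = (2 * K + 1) * (2 / b) * (F / (A * G))"
          if "K + 1 \<noteq> 0" "A \<noteq> 0" "G \<noteq> 0" "b \<noteq> 0" for K F A G b :: real
          using that by (simp add: divide_simps) (simp add: algebra_simps)
        have "fact (2 * k + 2) = 2 * (real k + 1) * ((2 * real k + 1) * fact (2 * k))"
          by (simp add: algebra_simps)
        then show ?thesis
          using aux[of "real k" "(2 / s\<^sup>2) ^ k" "fact k" "2 / s\<^sup>2" "fact (2 * k)"] s
          by (simp add: algebra_simps)
      qed
      finally show ?thesis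
        by (simp only: m2 even k)
    next
      case False
      then obtain k where k: "n = 2 * k + 1" by (auto elim: oddE)
      have "m (n + 2) = 0" using odd[of "k + 1"] by (simp add: k)
      moreover have "m n = 0" using odd[of k] by (simp add: k)
      ultimately show ?thesis by simp
    qed
    moreover have "expectation X = 0"
      using odd[of 0] by (simp add: m_def)
    ultimately show ?thesis
      using A by (simp add: all_moments_def m_def)
  qed
  then show "all_moments X" "expectation X = 0"
    "expectation (\<lambda>\<omega>. X \<omega> ^ (n + 2)) = real (n + 1) * expectation (\<lambda>\<omega>. (X \<omega>)\<^sup>2) * expectation (\<lambda>\<omega>. X \<omega> ^ n)"
    by auto
qed

text \<open>By the binomial theorem the expectation is a polynomial in \<open>e\<close>, and the
  derivative at 0 is its linear coefficient. No differentiation under the integral sign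
  occurs.\<close>

lemma has_derivative_moment_perturbation:
  assumes "all_moments Q" "all_moments Y" "all_moments Z"
  shows "((\<lambda>e. expectation (\<lambda>\<omega>. Q \<omega> * (Y \<omega> + e * Z \<omega>) ^ n)) has_real_derivative
            real n * expectation (\<lambda>\<omega>. Q \<omega> * Y \<omega> ^ (n - 1) * Z \<omega>)) (at 0)"
proof (cases n)
  case 0
  then show ?thesis by simp
next
  case (Suc k)
  define c where "c j = real (n choose j) * expectation (\<lambda>\<omega>. Q \<omega> * Z \<omega> ^ j * Y \<omega> ^ (n - j))" for j
  have eq: "expectation (\<lambda>\<omega>. Q \<omega> * (Y \<omega> + e * Z \<omega>) ^ n) = (\<Sum>j\<le>n. c j * e ^ j)" for e
  proof -
    have "expectation (\<lambda>\<omega>. Q \<omega> * (Y \<omega> + e * Z \<omega>) ^ n)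
      = expectation (\<lambda>\<omega>. \<Sum>j\<le>n. (real (n choose j) * e ^ j) * (Q \<omega> * Z \<omega> ^ j * Y \<omega> ^ (n - j)))"
      by (subst add.commute)
         (simp add: binomial_ring sum_distrib_left power_mult_distrib mult_ac)
    also have "\<dots> = (\<Sum>j\<le>n. expectation (\<lambda>\<omega>. (real (n choose j) * e ^ j) * (Q \<omega> * Z \<omega> ^ j * Y \<omega> ^ (n - j))))"
      by (intro Bochner_Integration.integral_sum all_moments_integrable all_moments_intros assms)
    also have "\<dots> = (\<Sum>j\<le>n. c j * e ^ j)"
      unfolding c_def by (intro sum.cong refl, subst integral_mult_right_zero) (simp add: mult_ac)
    finally show ?thesis .
  qed
  have "((\<lambda>e. \<Sum>j\<le>n. c j * e ^ j) has_real_derivative (\<Sum>j\<le>n. c j * (real j * 0 ^ (j - 1)))) (at 0)"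
    by (auto intro!: derivative_eq_intros simp: mult_ac)
  also have "(\<Sum>j\<le>n. c j * (real j * 0 ^ (j - 1))) = (\<Sum>j\<in>{1}. c j * (real j * 0 ^ (j - 1)))"
    by (rule sum.mono_neutral_right) (auto simp: Suc)
  also have "\<dots> = real n * expectation (\<lambda>\<omega>. Q \<omega> * Y \<omega> ^ (n - 1) * Z \<omega>)"
    by (simp add: c_def mult_ac)
  finally show ?thesis
    by (simp only: eq)
qed

end

subsection \<open>Integration by parts for polynomials of Gaussian variables\<close>

text \<open>Closure under \<open>X + e * Y\<close> supplies the perturbations along which moment
  identities are differentiated.\<close>

locale gaussian_space = prob_space M for M :: "'a measure" +
  fixes V :: "('a \<Rightarrow> real) set"
  assumes lin: "X \<in> V \<Longrightarrow> Y \<in> V \<Longrightarrow> (\<lambda>\<omega>. X \<omega> + e * Y \<omega>) \<in> V"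
    and gauss: "X \<in> V \<Longrightarrow> centred_gaussian M X"
begin

lemma all_moments_V: "X \<in> V \<Longrightarrow> all_moments X"
  using gauss centred_gaussian_moments(1) by blast

text \<open>\<open>gpoly h dh\<close>: \<open>h\<close> is a polynomial in elements of \<open>V\<close> and \<open>dh X\<close> is its Malliavin
  derivative \<open>\<langle>Dh, X\<rangle>\<close> in the direction \<open>X\<close>, where \<open>\<langle>DY, X\<rangle> = E (X Y)\<close> for \<open>Y \<in> V\<close>.\<close>

inductive gpoly :: "('a \<Rightarrow> real) \<Rightarrow> (('a \<Rightarrow> real) \<Rightarrow> 'a \<Rightarrow> real) \<Rightarrow> bool" where
  const: "gpoly (\<lambda>_. c) (\<lambda>_ _. 0)"
| vmult: "Y \<in> V \<Longrightarrow> gpoly h dh \<Longrightarrow>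
    gpoly (\<lambda>\<omega>. Y \<omega> * h \<omega>) (\<lambda>X \<omega>. expectation (\<lambda>\<omega>. X \<omega> * Y \<omega>) * h \<omega> + Y \<omega> * dh X \<omega>)"
| add: "gpoly h dh \<Longrightarrow> gpoly g dg \<Longrightarrow>
    gpoly (\<lambda>\<omega>. h \<omega> + g \<omega>) (\<lambda>X \<omega>. dh X \<omega> + dg X \<omega>)"

lemma all_moments_gpoly:
  assumes "gpoly h dh"
  shows "all_moments h" and "X \<in> V \<Longrightarrow> all_moments (dh X)"
proof -
  have "all_moments h \<and> (\<forall>X\<in>V. all_moments (dh X))"
    using assms
    by induction (auto intro!: all_moments_intros dest: all_moments_V)
  then show "all_moments h" "X \<in> V \<Longrightarrow> all_moments (dh X)" by auto
qed

lemma gpoly_mult: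
  assumes "gpoly h dh" "gpoly g dg"
  shows "gpoly (\<lambda>\<omega>. h \<omega> * g \<omega>) (\<lambda>X \<omega>. dh X \<omega> * g \<omega> + h \<omega> * dg X \<omega>)"
  using assms(1)
proof induction
  case (const c)
  \<comment> \<open>The rules of \<open>gpoly\<close> multiply by elements of \<open>V\<close> only,
    so a constant factor has to be pushed through the second polynomial by an induction of its
    own.\<close>
  show ?case using assms(2)
  proof induction
    case (const d)
    show ?case using gpoly.const[of "c * d"] by simp
  next
    case (vmult Y h dh)
    show ?case using gpoly.vmult[OF vmult(1,3)] by (simp add: algebra_simps)
  next
    case (add h dh g dg)
    show ?case using gpoly.add[OF add(3,4)] by (simp add: algebra_simps)
  qed
next
  case (vmult Y h dh)
  show ?case using gpoly.vmult[OF vmult(1,3)] by (simp add: algebra_simps)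
next
  case (add h dh g' dg')
  show ?case using gpoly.add[OF add(3,4)] by (simp add: algebra_simps)
qed

lemma gpoly_V: "Y \<in> V \<Longrightarrow> gpoly Y (\<lambda>X \<omega>. expectation (\<lambda>\<omega>. X \<omega> * Y \<omega>))"
  using gpoly.vmult[OF _ gpoly.const[of 1]] by simp

lemma gpoly_cmult: "gpoly h dh \<Longrightarrow> gpoly (\<lambda>\<omega>. c * h \<omega>) (\<lambda>X \<omega>. c * dh X \<omega>)"
  using gpoly_mult[OF gpoly.const[of c]] by simp

lemma gpoly_power:
  assumes "gpoly h dh"
  shows "gpoly (\<lambda>\<omega>. h \<omega> ^ n) (\<lambda>X \<omega>. real n * h \<omega> ^ (n - 1) * dh X \<omega>)"
proof (induction n)
  case 0
  show ?case using gpoly.const[of 1] by simp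
next
  case (Suc n)
  have "(\<lambda>X \<omega>. dh X \<omega> * h \<omega> ^ n + h \<omega> * (real n * h \<omega> ^ (n - 1) * dh X \<omega>)) =
      (\<lambda>X \<omega>. real (Suc n) * h \<omega> ^ (Suc n - 1) * dh X \<omega>)"
    by (cases n) (auto simp: algebra_simps)
  then show ?case
    using gpoly_mult[OF assms Suc] by simp
qed

lemma gpoly_sum:
  assumes "\<And>i. i \<in> I \<Longrightarrow> gpoly (f i) (df i)"
  shows "gpoly (\<lambda>\<omega>. \<Sum>i\<in>I. f i \<omega>) (\<lambda>X \<omega>. \<Sum>i\<in>I. df i X \<omega>)"
  using assms
proof (induction I rule: infinite_finite_induct)
  case (insert i I)
  then show ?case using gpoly.add[of "f i" "df i"] by simp
qed (use gpoly.const[of 0] in auto)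

text \<open>Integration by parts for a pure power. The moment recursion for
  \<open>Z = Y + e * X\<close> is differentiated at \<open>e = 0\<close>; since the variance of
  \<open>Z\<close> is itself a moment, its derivative \<open>2 * E (X Y)\<close> produces the
  covariance. The other term contains \<open>E (X Y^n)\<close>, two exponents lower, which dictates
  the two-step induction.\<close>

lemma expectation_power_mult:
  assumes X: "X \<in> V" and Y: "Y \<in> V"
  shows "expectation (\<lambda>\<omega>. X \<omega> * Y \<omega> ^ n) =
    real n * expectation (\<lambda>\<omega>. X \<omega> * Y \<omega>) * expectation (\<lambda>\<omega>. Y \<omega> ^ (n - 1))"
proof (induction n rule: induct_nat_012)
  case 0
  then show ?case using centred_gaussian_moments(2)[OF gauss[OF X]] by simp
next
  case 1
  then show ?case by (simp add: prob_space)
next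
  case (ge2 n)
  note am = all_moments_V[OF X] all_moments_V[OF Y]
  let ?C = "expectation (\<lambda>\<omega>. X \<omega> * Y \<omega>)"
  let ?m = "\<lambda>k. expectation (\<lambda>\<omega>. Y \<omega> ^ k)"
  define k where "k = n + 2"
  have eq: "expectation (\<lambda>\<omega>. 1 * (Y \<omega> + e * X \<omega>) ^ (k + 1)) =
      real k * expectation (\<lambda>\<omega>. 1 * (Y \<omega> + e * X \<omega>) ^ 2) * expectation (\<lambda>\<omega>. 1 * (Y \<omega> + e * X \<omega>) ^ (k - 1))" for e
    using centred_gaussian_moments(3)[OF gauss[OF lin[OF Y X, of e]], of "k - 1"]
    by (simp add: k_def)
  have "((\<lambda>e. real k * expectation (\<lambda>\<omega>. 1 * (Y \<omega> + e * X \<omega>) ^ 2) * expectation (\<lambda>\<omega>. 1 * (Y \<omega> + e * X \<omega>) ^ (k - 1)))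
    has_real_derivative
     real k * (2 * ?C) * ?m (k - 1) + real k * ?m 2 * (real (k - 1) * expectation (\<lambda>\<omega>. X \<omega> * Y \<omega> ^ n))) (at 0)"
    by (rule derivative_eq_intros has_derivative_moment_perturbation all_moments_const am refl)+
       (simp add: k_def mult_ac)
  moreover have "((\<lambda>e. expectation (\<lambda>\<omega>. 1 * (Y \<omega> + e * X \<omega>) ^ (k + 1))) has_real_derivative
       real (k + 1) * expectation (\<lambda>\<omega>. 1 * Y \<omega> ^ (k + 1 - 1) * X \<omega>)) (at 0)"
    by (rule has_derivative_moment_perturbation all_moments_const am)+
  ultimately have "real (k + 1) * expectation (\<lambda>\<omega>. 1 * Y \<omega> ^ (k + 1 - 1) * X \<omega>) =
      real k * (2 * ?C) * ?m (k - 1) + real k * ?m 2 * (real (k - 1) * expectation (\<lambda>\<omega>. X \<omega> * Y \<omega> ^ n))"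
    unfolding eq using DERIV_unique by blast
  \<comment> \<open>For \<open>n = 0\<close> both sides vanish with the first moments; otherwise the
    induction hypothesis and the moment recursion \<open>m (n + 1) = n * m 2 * m (n - 1)\<close>
    turn the remainder into a multiple of the covariance.\<close>
  moreover have "?m 2 * (real (k - 1) * expectation (\<lambda>\<omega>. X \<omega> * Y \<omega> ^ n)) = ?C * (real (k - 1) * ?m (k - 1))"
  proof (cases n)
    case 0
    then show ?thesis
      using centred_gaussian_moments(2)[OF gauss[OF X]] centred_gaussian_moments(2)[OF gauss[OF Y]]
      by (simp add: k_def)
  next
    case (Suc j)
    have "?m (k - 1) = real n * ?m 2 * ?m (n - 1)"
      using centred_gaussian_moments(3)[OF gauss[OF Y], of j] by (simp add: k_def Suc)
    then show ?thesis
      unfolding ge2(1) by (simp only: mult_ac)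
  qed
  ultimately have "real (k + 1) * expectation (\<lambda>\<omega>. X \<omega> * Y \<omega> ^ k) =
      real k * (2 * ?C) * ?m (k - 1) + real k * (?C * (real (k - 1) * ?m (k - 1)))"
    by (simp add: mult_ac)
  also have "\<dots> = real (k + 1) * (real k * ?C * ?m (k - 1))"
    by (simp add: k_def algebra_simps)
  finally have "expectation (\<lambda>\<omega>. X \<omega> * Y \<omega> ^ k) = real k * ?C * ?m (k - 1)"
    by (simp only: mult_left_cancel of_nat_eq_0_iff)
  then show ?case
    by (simp only: k_def add_2_eq_Suc')
qed

text \<open>Replacing \<open>Y\<close> by \<open>Y + e Z\<close> in the induction hypothesis and differentiating at \<open>e = 0\<close>
  multiplies the polynomial \<open>h\<close> by \<open>Z\<close>.\<close>

lemma gpoly_integration_by_parts_power: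
  assumes "gpoly h dh" "X \<in> V" "Y \<in> V"
  shows "expectation (\<lambda>\<omega>. X \<omega> * h \<omega> * Y \<omega> ^ n) =
    real n * expectation (\<lambda>\<omega>. X \<omega> * Y \<omega>) * expectation (\<lambda>\<omega>. h \<omega> * Y \<omega> ^ (n - 1))
    + expectation (\<lambda>\<omega>. dh X \<omega> * Y \<omega> ^ n)"
  using assms
proof (induction arbitrary: Y n)
  case (const c)
  then show ?case
    using expectation_power_mult[of X Y n] by (simp add: mult.commute[of _ c] mult.assoc)
next
  case (vmult Z h dh)
  note am = all_moments_V[OF vmult.prems(1)] all_moments_V[OF vmult.prems(2)]
    all_moments_V[OF vmult.hyps(1)] all_moments_gpoly(1)[OF vmult.hyps(2)]
    all_moments_gpoly(2)[OF vmult.hyps(2) vmult.prems(1)]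
  note I = all_moments_integrable all_moments_intros am
  have lin_e: "expectation (\<lambda>\<omega>. X \<omega> * (Y \<omega> + e * Z \<omega>)) =
      expectation (\<lambda>\<omega>. X \<omega> * Y \<omega>) + e * expectation (\<lambda>\<omega>. X \<omega> * Z \<omega>)" for e
  proof -
    have "expectation (\<lambda>\<omega>. X \<omega> * (Y \<omega> + e * Z \<omega>)) = expectation (\<lambda>\<omega>. X \<omega> * Y \<omega> + e * (X \<omega> * Z \<omega>))"
      by (simp add: algebra_simps)
    also have "\<dots> = expectation (\<lambda>\<omega>. X \<omega> * Y \<omega>) + e * expectation (\<lambda>\<omega>. X \<omega> * Z \<omega>)"
      by (subst Bochner_Integration.integral_add) (auto intro!: I)
    finally show ?thesis .
  qed
  \<comment> \<open>The hypothesis is used with exponent \<open>n + 1\<close>: differentiation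
    lowers it to \<open>n\<close> and brings down the factor \<open>n + 1\<close>, nonzero even for
    \<open>n = 0\<close>, which is cancelled in \<open>main\<close>.\<close>
  have eq: "expectation (\<lambda>\<omega>. (X \<omega> * h \<omega>) * (Y \<omega> + e * Z \<omega>) ^ (n + 1)) =
     real (n + 1) * (expectation (\<lambda>\<omega>. X \<omega> * Y \<omega>) + e * expectation (\<lambda>\<omega>. X \<omega> * Z \<omega>)) *
       expectation (\<lambda>\<omega>. h \<omega> * (Y \<omega> + e * Z \<omega>) ^ n)
     + expectation (\<lambda>\<omega>. dh X \<omega> * (Y \<omega> + e * Z \<omega>) ^ (n + 1))" for e
    using vmult.IH[OF vmult.prems(1) lin[OF vmult.prems(2) vmult.hyps(1), of e], of "n + 1"]
    by (simp only: lin_e add_diff_cancel_right')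
  have "((\<lambda>e. real (n + 1) * (expectation (\<lambda>\<omega>. X \<omega> * Y \<omega>) + e * expectation (\<lambda>\<omega>. X \<omega> * Z \<omega>)) *
       expectation (\<lambda>\<omega>. h \<omega> * (Y \<omega> + e * Z \<omega>) ^ n)
     + expectation (\<lambda>\<omega>. dh X \<omega> * (Y \<omega> + e * Z \<omega>) ^ (n + 1))) has_real_derivative
     real (n + 1) * expectation (\<lambda>\<omega>. X \<omega> * Z \<omega>) * expectation (\<lambda>\<omega>. h \<omega> * Y \<omega> ^ n)
     + real (n + 1) * expectation (\<lambda>\<omega>. X \<omega> * Y \<omega>) * (real n * expectation (\<lambda>\<omega>. h \<omega> * Y \<omega> ^ (n - 1) * Z \<omega>))
     + real (n + 1) * expectation (\<lambda>\<omega>. dh X \<omega> * Y \<omega> ^ (n + 1 - 1) * Z \<omega>)) (at 0)"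
    by (rule derivative_eq_intros has_derivative_moment_perturbation am refl)+
       (simp add: algebra_simps)
  moreover have "((\<lambda>e. expectation (\<lambda>\<omega>. (X \<omega> * h \<omega>) * (Y \<omega> + e * Z \<omega>) ^ (n + 1))) has_real_derivative
     real (n + 1) * expectation (\<lambda>\<omega>. (X \<omega> * h \<omega>) * Y \<omega> ^ (n + 1 - 1) * Z \<omega>)) (at 0)"
    by (rule has_derivative_moment_perturbation all_moments_mult am)+
  ultimately have "real (n + 1) * expectation (\<lambda>\<omega>. (X \<omega> * h \<omega>) * Y \<omega> ^ (n + 1 - 1) * Z \<omega>) =
     real (n + 1) * expectation (\<lambda>\<omega>. X \<omega> * Z \<omega>) * expectation (\<lambda>\<omega>. h \<omega> * Y \<omega> ^ n)
     + real (n + 1) * expectation (\<lambda>\<omega>. X \<omega> * Y \<omega>) * (real n * expectation (\<lambda>\<omega>. h \<omega> * Y \<omega> ^ (n - 1) * Z \<omega>))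
     + real (n + 1) * expectation (\<lambda>\<omega>. dh X \<omega> * Y \<omega> ^ (n + 1 - 1) * Z \<omega>)"
    unfolding eq using DERIV_unique by blast
  also have "\<dots> = real (n + 1) * (expectation (\<lambda>\<omega>. X \<omega> * Z \<omega>) * expectation (\<lambda>\<omega>. h \<omega> * Y \<omega> ^ n)
     + expectation (\<lambda>\<omega>. X \<omega> * Y \<omega>) * (real n * expectation (\<lambda>\<omega>. h \<omega> * Y \<omega> ^ (n - 1) * Z \<omega>))
     + expectation (\<lambda>\<omega>. dh X \<omega> * Y \<omega> ^ (n + 1 - 1) * Z \<omega>))"
    by (simp only: distrib_left mult.assoc)
  finally have main: "expectation (\<lambda>\<omega>. (X \<omega> * h \<omega>) * Y \<omega> ^ n * Z \<omega>) =
     expectation (\<lambda>\<omega>. X \<omega> * Z \<omega>) * expectation (\<lambda>\<omega>. h \<omega> * Y \<omega> ^ n)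
     + expectation (\<lambda>\<omega>. X \<omega> * Y \<omega>) * (real n * expectation (\<lambda>\<omega>. h \<omega> * Y \<omega> ^ (n - 1) * Z \<omega>))
     + expectation (\<lambda>\<omega>. dh X \<omega> * Y \<omega> ^ n * Z \<omega>)"
    by (simp only: mult_left_cancel of_nat_eq_0_iff add_diff_cancel_right')
  have "expectation (\<lambda>\<omega>. (expectation (\<lambda>\<omega>. X \<omega> * Z \<omega>) * h \<omega> + Z \<omega> * dh X \<omega>) * Y \<omega> ^ n) =
      expectation (\<lambda>\<omega>. expectation (\<lambda>\<omega>. X \<omega> * Z \<omega>) * (h \<omega> * Y \<omega> ^ n) + dh X \<omega> * Y \<omega> ^ n * Z \<omega>)"
    by (simp add: algebra_simps)
  also have "\<dots> = expectation (\<lambda>\<omega>. X \<omega> * Z \<omega>) * expectation (\<lambda>\<omega>. h \<omega> * Y \<omega> ^ n)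
      + expectation (\<lambda>\<omega>. dh X \<omega> * Y \<omega> ^ n * Z \<omega>)"
    by (subst Bochner_Integration.integral_add) (auto intro!: I)
  finally show ?case
    using main by (simp add: mult_ac)
next
  case (add h dh g dg)
  note am = all_moments_V[OF add.prems(1)] all_moments_V[OF add.prems(2)]
    all_moments_gpoly(1)[OF add.hyps(1)] all_moments_gpoly(1)[OF add.hyps(2)]
    all_moments_gpoly(2)[OF add.hyps(1) add.prems(1)]
    all_moments_gpoly(2)[OF add.hyps(2) add.prems(1)]
  note I = all_moments_integrable all_moments_intros am
  show ?case
    unfolding distrib_left distrib_right
    using add.IH(1)[OF add.prems, of n] add.IH(2)[OF add.prems, of n]
    by (subst (1 2 3) Bochner_Integration.integral_add) (auto intro!: I simp: algebra_simps)
qed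

text \<open>The power \<open>Y ^ n\<close> only carried the differentiation argument; exponent 0
  removes it.\<close>

corollary gpoly_integration_by_parts:
  assumes "gpoly h dh" "X \<in> V"
  shows "expectation (\<lambda>\<omega>. X \<omega> * h \<omega>) = expectation (dh X)"
  using gpoly_integration_by_parts_power[OF assms assms(2), of 0] by simp

end

subsection \<open>Moments of Gaussian quadratic forms\<close>

locale gaussian_vector = gaussian_space M V for M :: "'a measure" and V +
  fixes D :: "nat \<Rightarrow> 'a \<Rightarrow> real" and N :: nat and a :: real
  assumes D_V: "D i \<in> V"
begin

definition cov :: "nat \<Rightarrow> nat \<Rightarrow> real" where
  "cov i j = expectation (\<lambda>\<omega>. D i \<omega> * D j \<omega>)"

fun cov_power :: "nat \<Rightarrow> nat \<Rightarrow> nat \<Rightarrow> real" where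
  "cov_power 0 i j = (if i = j then 1 else 0)"
| "cov_power (Suc r) i j = (\<Sum>k<N. cov i k * cov_power r k j)"

text \<open>Built from the Wick products \<open>D i * D j - cov i j\<close>, so it has mean zero and
  one integration by parts leaves no contraction inside the form itself.\<close>

definition quadratic :: "(nat \<Rightarrow> nat \<Rightarrow> real) \<Rightarrow> 'a \<Rightarrow> real" where
  "quadratic A \<omega> = (\<Sum>i<N. \<Sum>j<N. A i j * (D i \<omega> * D j \<omega> - cov i j))"

definition Q :: "'a \<Rightarrow> real" where
  "Q \<omega> = a * (\<Sum>i<N. (D i \<omega>)\<^sup>2 - cov i i)"

lemma cov_sym: "cov i j = cov j i"
  by (simp add: cov_def mult.commute)

lemma cov_power_1:
  assumes "j < N"
  shows "cov_power (Suc 0) i j = cov i j"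
proof -
  have "cov_power (Suc 0) i j = (\<Sum>k\<in>{j}. cov i k * cov_power 0 k j)"
    unfolding cov_power.simps(2) by (rule sum.mono_neutral_right) (use assms in auto)
  then show ?thesis by simp
qed

lemma quadratic_cov_power_0: "a * quadratic (cov_power 0) \<omega> = Q \<omega>"
proof -
  have "(\<Sum>j<N. cov_power 0 i j * (D i \<omega> * D j \<omega> - cov i j)) = (D i \<omega>)\<^sup>2 - cov i i" if "i < N" for i
  proof -
    have "(\<Sum>j<N. cov_power 0 i j * (D i \<omega> * D j \<omega> - cov i j))
      = (\<Sum>j\<in>{i}. cov_power 0 i j * (D i \<omega> * D j \<omega> - cov i j))"
      by (rule sum.mono_neutral_right) (use that in auto)
    then show ?thesis by (simp add: power2_eq_square)
  qed
  then show ?thesis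
    by (simp add: quadratic_def Q_def)
qed

lemma gpoly_Q: "gpoly Q (\<lambda>X \<omega>. a * (\<Sum>i<N. 2 * expectation (\<lambda>\<omega>. X \<omega> * D i \<omega>) * D i \<omega>))"
proof -
  have "gpoly (\<lambda>\<omega>. a * (\<Sum>i<N. (D i \<omega>) ^ 2 + - cov i i))
      (\<lambda>X \<omega>. a * (\<Sum>i<N. real 2 * (D i \<omega>) ^ (2 - 1) * expectation (\<lambda>\<omega>. X \<omega> * D i \<omega>) + 0))"
    by (intro gpoly_cmult gpoly_sum gpoly.add gpoly_power gpoly_V D_V gpoly.const)
  moreover have "(\<lambda>\<omega>. a * (\<Sum>i<N. (D i \<omega>) ^ 2 + - cov i i)) = Q"
    by (simp add: Q_def fun_eq_iff)
  ultimately show ?thesis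
    by (simp add: mult_ac)
qed

lemma all_moments_D: "all_moments (D i)"
  by (rule all_moments_V[OF D_V])

lemma all_moments_Q: "all_moments Q"
  using all_moments_gpoly(1)[OF gpoly_Q] .

lemma all_moments_quadratic: "all_moments (quadratic A)"
proof -
  have "all_moments (\<lambda>\<omega>. \<Sum>i<N. \<Sum>j<N. A i j * (D i \<omega> * D j \<omega> + - cov i j))"
    by (intro all_moments_intros all_moments_D)
  then show ?thesis by (simp add: quadratic_def[abs_def])
qed

lemma expectation_quadratic: "expectation (quadratic A) = 0"
proof -
  have "expectation (quadratic A) = (\<Sum>i<N. \<Sum>j<N. A i j * expectation (\<lambda>\<omega>. D i \<omega> * D j \<omega> + - cov i j))"
    unfolding quadratic_def diff_conv_add_uminus
    by (subst Bochner_Integration.integral_sum Bochner_Integration.integral_mult_right_zero |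
        intro all_moments_integrable all_moments_intros all_moments_D sum.cong refl)+
  moreover have "expectation (\<lambda>\<omega>. D i \<omega> * D j \<omega> + - cov i j) = 0" for i j
    by (subst Bochner_Integration.integral_add)
       (auto intro!: all_moments_integrable all_moments_intros all_moments_D simp: cov_def[symmetric] prob_space)
  ultimately show ?thesis by simp
qed

text \<open>Integrating by parts in \<open>D i\<close>, the derivative falls either on
  \<open>D j\<close> or on \<open>h\<close>. The first contribution is \<open>cov i j * E h\<close>,
  exactly what the centring subtracts.\<close>

lemma expectation_quadratic_mult:
  assumes h: "gpoly h dh"
  shows "expectation (\<lambda>\<omega>. quadratic A \<omega> * h \<omega>) =
    (\<Sum>i<N. \<Sum>j<N. A i j * expectation (\<lambda>\<omega>. D j \<omega> * dh (D i) \<omega>))"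
proof -
  note am = all_moments_D all_moments_gpoly(1)[OF h] all_moments_gpoly(2)[OF h D_V]
  note I = all_moments_integrable all_moments_intros am
  have e: "expectation (\<lambda>\<omega>. (D i \<omega> * D j \<omega> - cov i j) * h \<omega>) = expectation (\<lambda>\<omega>. D j \<omega> * dh (D i) \<omega>)" for i j
  proof -
    have "expectation (\<lambda>\<omega>. D i \<omega> * (D j \<omega> * h \<omega>)) =
      expectation (\<lambda>\<omega>. cov i j * h \<omega> + D j \<omega> * dh (D i) \<omega>)"
      using gpoly_integration_by_parts[OF gpoly.vmult[OF D_V h] D_V, of i j] by (simp add: cov_def)
    also have "\<dots> = expectation (\<lambda>\<omega>. cov i j * h \<omega>) + expectation (\<lambda>\<omega>. D j \<omega> * dh (D i) \<omega>)"
      by (subst Bochner_Integration.integral_add) (auto intro!: I)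
    moreover have "expectation (\<lambda>\<omega>. (D i \<omega> * D j \<omega> - cov i j) * h \<omega>) =
      expectation (\<lambda>\<omega>. D i \<omega> * (D j \<omega> * h \<omega>)) - expectation (\<lambda>\<omega>. cov i j * h \<omega>)"
      unfolding left_diff_distrib
      by (subst Bochner_Integration.integral_diff) (auto intro!: I simp: mult.assoc)
    ultimately show ?thesis by simp
  qed
  have "expectation (\<lambda>\<omega>. quadratic A \<omega> * h \<omega>) =
    expectation (\<lambda>\<omega>. \<Sum>i<N. \<Sum>j<N. A i j * ((D i \<omega> * D j \<omega> + - cov i j) * h \<omega>))"
    by (simp add: quadratic_def sum_distrib_right mult.assoc)
  also have "\<dots> = (\<Sum>i<N. \<Sum>j<N. A i j * expectation (\<lambda>\<omega>. (D i \<omega> * D j \<omega> + - cov i j) * h \<omega>))"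
    by (subst Bochner_Integration.integral_sum Bochner_Integration.integral_mult_right_zero |
        intro I sum.cong refl)+
  finally show ?thesis
    using e by simp
qed

text \<open>The cumulants of \<open>Q\<close> of order \<open>r + 2\<close>, divided by \<open>(r + 1)!\<close>.\<close>

definition \<tau> :: "nat \<Rightarrow> real" where
  "\<tau> r = a * (2 * a) ^ (r + 1) * (\<Sum>i<N. \<Sum>j<N. cov_power (Suc r) i j * cov i j)"

text \<open>Each derivative of \<open>Q\<close> contributes a factor \<open>2 * a\<close> and one
  more power of the covariance matrix. The normalisation absorbs these factors and makes
  \<open>r = 0\<close> the moment of order \<open>n + 1\<close> of \<open>Q\<close>.\<close>

definition mixed_moment :: "nat \<Rightarrow> nat \<Rightarrow> real" where
  "mixed_moment r n = a * (2 * a) ^ r * expectation (\<lambda>\<omega>. quadratic (cov_power r) \<omega> * Q \<omega> ^ n)"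

lemma mixed_moment_0_left: "mixed_moment 0 n = expectation (\<lambda>\<omega>. Q \<omega> ^ (n + 1))"
proof -
  have "mixed_moment 0 n = expectation (\<lambda>\<omega>. a * (quadratic (cov_power 0) \<omega> * Q \<omega> ^ n))"
    by (simp add: mixed_moment_def)
  also have "\<dots> = expectation (\<lambda>\<omega>. Q \<omega> ^ (n + 1))"
    by (simp add: quadratic_cov_power_0 mult.assoc[symmetric] del: cov_power.simps)
  finally show ?thesis .
qed

lemma mixed_moment_0_right: "mixed_moment r 0 = 0"
  by (simp add: mixed_moment_def expectation_quadratic)

text \<open>The derivative of \<open>Q\<close> in direction \<open>D i\<close> is \<open>2 a\<close>
  times the sum of \<open>cov i k * D k\<close>, so one integration by parts replaces the matrix
  power \<open>r\<close> by \<open>r + 1\<close>. The resulting form is not centred; its mean is the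
  trace of the power \<open>r + 2\<close>, which gives \<open>\<tau> r\<close>.\<close>

lemma mixed_moment_Suc:
  "mixed_moment r (Suc n) = real (Suc n) * (mixed_moment (Suc r) n + \<tau> r * expectation (\<lambda>\<omega>. Q \<omega> ^ n))"
proof -
  note I = all_moments_integrable all_moments_intros all_moments_D all_moments_Q all_moments_quadratic
  let ?A = "cov_power r"
  let ?E = "\<lambda>j k. expectation (\<lambda>\<omega>. D k \<omega> * D j \<omega> * Q \<omega> ^ n)"
  define tr where "tr = (\<Sum>k<N. \<Sum>j<N. cov_power (Suc r) k j * cov k j)"
  have "expectation (\<lambda>\<omega>. quadratic ?A \<omega> * Q \<omega> ^ Suc n) =
    (\<Sum>i<N. \<Sum>j<N. ?A i j * expectation (\<lambda>\<omega>. D j \<omega> *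
       (real (Suc n) * Q \<omega> ^ (Suc n - 1) * (a * (\<Sum>k<N. 2 * expectation (\<lambda>\<omega>. D i \<omega> * D k \<omega>) * D k \<omega>)))))"
    by (rule expectation_quadratic_mult[OF gpoly_power[OF gpoly_Q]])
  also have "\<dots> = (\<Sum>i<N. \<Sum>j<N. ?A i j * expectation (\<lambda>\<omega>. \<Sum>k<N. 2 * a * real (Suc n) * cov i k * (D k \<omega> * D j \<omega> * Q \<omega> ^ n)))"
    by (simp add: sum_distrib_left mult_ac cov_def del: of_nat_Suc)
  also have "\<dots> = (\<Sum>i<N. \<Sum>j<N. ?A i j * (\<Sum>k<N. 2 * a * real (Suc n) * cov i k * ?E j k))"
    by (subst Bochner_Integration.integral_sum Bochner_Integration.integral_mult_right_zero |
        intro I sum.cong refl arg_cong2[where f = times])+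
  also have "\<dots> = (\<Sum>i<N. \<Sum>j<N. \<Sum>k<N. 2 * a * real (Suc n) * (cov k i * ?A i j * ?E j k))"
    by (simp add: sum_distrib_left mult_ac cov_sym)
  also have "\<dots> = (\<Sum>k<N. \<Sum>j<N. \<Sum>i<N. 2 * a * real (Suc n) * (cov k i * ?A i j * ?E j k))"
    by (subst sum.swap, subst sum.swap, rule sum.swap)
  also have "\<dots> = 2 * a * real (Suc n) * (\<Sum>k<N. \<Sum>j<N. cov_power (Suc r) k j * ?E j k)"
    by (simp add: sum_distrib_left sum_distrib_right mult_ac)
  also have "(\<Sum>k<N. \<Sum>j<N. cov_power (Suc r) k j * ?E j k) =
      expectation (\<lambda>\<omega>. \<Sum>k<N. \<Sum>j<N. cov_power (Suc r) k j * (D k \<omega> * D j \<omega> * Q \<omega> ^ n))"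
    by (subst Bochner_Integration.integral_sum Bochner_Integration.integral_mult_right_zero |
        intro I sum.cong refl)+
  \<comment> \<open>Recentring: \<open>tr\<close> is the expectation of the uncentred form.\<close>
  also have "\<dots> = expectation (\<lambda>\<omega>. quadratic (cov_power (Suc r)) \<omega> * Q \<omega> ^ n + tr * Q \<omega> ^ n)"
  proof -
    have "quadratic (cov_power (Suc r)) \<omega> + tr = (\<Sum>k<N. \<Sum>j<N. cov_power (Suc r) k j * (D k \<omega> * D j \<omega>))" for \<omega>
      unfolding quadratic_def tr_def sum.distrib[symmetric] by (simp add: algebra_simps del: cov_power.simps)
    then show ?thesis
      unfolding distrib_right[symmetric] by (simp add: sum_distrib_right mult.assoc del: cov_power.simps)
  qed
  also have "\<dots> = expectation (\<lambda>\<omega>. quadratic (cov_power (Suc r)) \<omega> * Q \<omega> ^ n) + tr * expectation (\<lambda>\<omega>. Q \<omega> ^ n)"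
    by (subst Bochner_Integration.integral_add) (auto intro!: I simp del: cov_power.simps)
  finally have "expectation (\<lambda>\<omega>. quadratic ?A \<omega> * Q \<omega> ^ Suc n) = 2 * a * real (Suc n) *
    (expectation (\<lambda>\<omega>. quadratic (cov_power (Suc r)) \<omega> * Q \<omega> ^ n) + tr * expectation (\<lambda>\<omega>. Q \<omega> ^ n))" .
  then show ?thesis
    unfolding mixed_moment_def \<tau>_def tr_def[symmetric]
    by (simp only: mult_ac power_Suc Suc_eq_plus1[symmetric] distrib_left)
qed

lemma expectation_Q_power_2: "expectation (\<lambda>\<omega>. Q \<omega> ^ 2) = \<tau> 0"
  using mixed_moment_Suc[of 0 0] mixed_moment_0_left[of 1]
  by (simp add: mixed_moment_0_right prob_space numeral_2_eq_2)

text \<open>Four steps of the recursion; the third cumulant \<open>\<tau> 1\<close> drops out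
  because it multiplies the mean of \<open>Q\<close>, and \<open>6 * \<tau> 2\<close> is the fourth
  cumulant.\<close>

lemma expectation_Q_power_4: "expectation (\<lambda>\<omega>. Q \<omega> ^ 4) = 3 * (\<tau> 0)\<^sup>2 + 6 * \<tau> 2"
proof -
  have 1: "expectation Q = 0"
    using mixed_moment_0_left[of 0] by (simp add: mixed_moment_0_right)
  have "mixed_moment 2 1 = \<tau> 2"
    using mixed_moment_Suc[of 2 0] by (simp add: mixed_moment_0_right prob_space)
  then have "mixed_moment 1 2 = 2 * \<tau> 2"
    using mixed_moment_Suc[of 1 1] 1 by (simp add: numeral_2_eq_2)
  then have "mixed_moment 0 3 = 3 * (2 * \<tau> 2 + \<tau> 0 * \<tau> 0)"
    using mixed_moment_Suc[of 0 2] expectation_Q_power_2 by (simp add: numeral_3_eq_3 numeral_2_eq_2)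
  then show ?thesis
    using mixed_moment_0_left[of 3] by (simp add: power2_eq_square)
qed

section \<open>Cumulant bounds through the squared Frobenius norm\<close>

definition frob :: "(nat \<Rightarrow> nat \<Rightarrow> real) \<Rightarrow> real" where
  "frob A = (\<Sum>i<N. \<Sum>j<N. (A i j)\<^sup>2)"

lemma \<tau>_0: "\<tau> 0 = 2 * a\<^sup>2 * frob cov"
proof -
have "(\<Sum>i<N. \<Sum>j<N. cov_power (Suc 0) i j * cov i j) = frob cov"
    by (simp add: cov_power_1 frob_def power2_eq_square del: cov_power.simps)
  then show ?thesis
    by (simp add: \<tau>_def power2_eq_square del: cov_power.simps)
qed

context
  fixes R assumes R: "\<And>i. i < N \<Longrightarrow> (\<Sum>j<N. \<bar>cov i j\<bar>) \<le> R"
begin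

text \<open>This is the Schur test: for a symmetric matrix a bound \<open>R\<close> on the absolute
  row sums is also one on the column sums, hence on the operator norm.\<close>

lemma frob_cov_mult: "frob (\<lambda>i j. \<Sum>k<N. cov i k * A k j) \<le> R\<^sup>2 * frob A"
proof -
  have "(\<Sum>k<N. cov i k * A k j)\<^sup>2 \<le> R * (\<Sum>k<N. \<bar>cov i k\<bar> * (A k j)\<^sup>2)" if "i < N" for i j
  proof -
    have "\<bar>\<Sum>k<N. cov i k * A k j\<bar> \<le> (\<Sum>k<N. \<bar>cov i k * A k j\<bar>)"
      by (rule sum_abs)
    \<comment> \<open>Splitting the weight into two square roots lets Cauchy-Schwarz put one copy
      into the row sum and keep the other with \<open>A\<close>.\<close>
    also have "\<dots> = (\<Sum>k<N. sqrt \<bar>cov i k\<bar> * (sqrt \<bar>cov i k\<bar> * \<bar>A k j\<bar>))"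
      by (simp add: mult.assoc[symmetric] abs_mult)
    finally have "(\<Sum>k<N. cov i k * A k j)\<^sup>2 \<le> (\<Sum>k<N. sqrt \<bar>cov i k\<bar> * (sqrt \<bar>cov i k\<bar> * \<bar>A k j\<bar>))\<^sup>2"
      using power_mono[of "\<bar>\<Sum>k<N. cov i k * A k j\<bar>" _ 2] by simp
    also have "\<dots> \<le> (\<Sum>k<N. (sqrt \<bar>cov i k\<bar>)\<^sup>2) * (\<Sum>k<N. (sqrt \<bar>cov i k\<bar> * \<bar>A k j\<bar>)\<^sup>2)"
      by (rule Cauchy_Schwarz_ineq_sum)
    also have "\<dots> = (\<Sum>k<N. \<bar>cov i k\<bar>) * (\<Sum>k<N. \<bar>cov i k\<bar> * (A k j)\<^sup>2)"
      by (simp add: power_mult_distrib)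
    also have "\<dots> \<le> R * (\<Sum>k<N. \<bar>cov i k\<bar> * (A k j)\<^sup>2)"
      by (intro mult_right_mono R that sum_nonneg) auto
    finally show ?thesis .
  qed
  then have "frob (\<lambda>i j. \<Sum>k<N. cov i k * A k j) \<le> (\<Sum>i<N. \<Sum>j<N. R * (\<Sum>k<N. \<bar>cov i k\<bar> * (A k j)\<^sup>2))"
    unfolding frob_def by (intro sum_mono) auto
  also have "\<dots> = R * (\<Sum>i<N. \<Sum>j<N. \<Sum>k<N. \<bar>cov i k\<bar> * (A k j)\<^sup>2)"
    by (simp add: sum_distrib_left)
  also have "(\<Sum>i<N. \<Sum>j<N. \<Sum>k<N. \<bar>cov i k\<bar> * (A k j)\<^sup>2) = (\<Sum>k<N. \<Sum>j<N. \<Sum>i<N. \<bar>cov i k\<bar> * (A k j)\<^sup>2)"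
    by (subst sum.swap, subst sum.swap, rule sum.swap)
  also have "\<dots> = (\<Sum>k<N. \<Sum>j<N. (\<Sum>i<N. \<bar>cov k i\<bar>) * (A k j)\<^sup>2)"
    by (simp add: sum_distrib_right cov_sym)
  also have "R * \<dots> \<le> R * (\<Sum>k<N. \<Sum>j<N. R * (A k j)\<^sup>2)"
  \<comment> \<open>For \<open>N = 0\<close> the hypothesis says nothing about the sign of
    \<open>R\<close>, but the sums are empty. For the same reason \<open>\<tau>_bound\<close> is
    stated with the absolute value of \<open>R\<close>.\<close>
  proof (cases "N = 0")
    case False
    then have "0 \<le> R"
      using R[of 0] by (meson abs_ge_zero gr0I order_trans sum_nonneg)
    then show ?thesis
      by (intro mult_left_mono sum_mono mult_right_mono R) auto
  qed simp
  also have "\<dots> = R\<^sup>2 * frob A"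
    by (simp add: frob_def sum_distrib_left power2_eq_square mult.assoc)
  finally show ?thesis .
qed

lemma frob_cov_power: "frob (cov_power (Suc r)) \<le> (R ^ r)\<^sup>2 * frob cov"
proof (induction r)
  case 0
show ?case by (simp add: cov_power_1 frob_def del: cov_power.simps)
next
  case (Suc r)
  have "frob (cov_power (Suc (Suc r))) \<le> R\<^sup>2 * frob (cov_power (Suc r))"
    using frob_cov_mult[of "cov_power (Suc r)"] by (subst cov_power.simps(2)[abs_def])
  also have "\<dots> \<le> R\<^sup>2 * ((R ^ r)\<^sup>2 * frob cov)"
    by (intro mult_left_mono Suc) auto
  finally show ?case by (simp add: power_mult_distrib mult_ac del: cov_power.simps)
qed

text \<open>Cauchy-Schwarz for the trace pairs the power \<open>r + 1\<close> with the matrix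
  itself, and the Schur test reduces both factors to \<open>frob cov\<close>. Once the variance
  \<open>\<tau> 0\<close> is normalised, each further order costs a factor
  \<open>2 |a| |R|\<close>.\<close>

lemma \<tau>_bound: "\<bar>\<tau> r\<bar> \<le> \<tau> 0 * (2 * \<bar>a\<bar> * \<bar>R\<bar>) ^ r"
proof -
  let ?S = "\<Sum>i<N. \<Sum>j<N. cov_power (Suc r) i j * cov i j"
  have "?S\<^sup>2 = (\<Sum>(i, j)\<in>{..<N} \<times> {..<N}. cov_power (Suc r) i j * cov i j)\<^sup>2"
    by (simp add: sum.cartesian_product)
  also have "\<dots> \<le> (\<Sum>(i, j)\<in>{..<N} \<times> {..<N}. (cov_power (Suc r) i j)\<^sup>2) * (\<Sum>(i, j)\<in>{..<N} \<times> {..<N}. (cov i j)\<^sup>2)"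
    using Cauchy_Schwarz_ineq_sum[of "\<lambda>(i, j). cov_power (Suc r) i j" "\<lambda>(i, j). cov i j" "{..<N} \<times> {..<N}"]
    by (simp add: case_prod_unfold)
  also have "\<dots> = frob (cov_power (Suc r)) * frob cov"
    by (simp add: frob_def sum.cartesian_product)
  also have "\<dots> \<le> (R ^ r)\<^sup>2 * frob cov * frob cov"
    by (intro mult_right_mono frob_cov_power) (auto simp: frob_def intro!: sum_nonneg)
  also have "\<dots> = (\<bar>R\<bar> ^ r * frob cov)\<^sup>2"
    by (simp add: power_mult_distrib power_abs[symmetric]) (simp add: power2_eq_square)
  finally have "\<bar>?S\<bar> \<le> \<bar>R\<bar> ^ r * frob cov"
    by (rule abs_le_square_iff[THEN iffD2, THEN order_trans]) (simp add: frob_def sum_nonneg)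
  then have "\<bar>a * (2 * a) ^ (r + 1)\<bar> * \<bar>?S\<bar> \<le> \<bar>a * (2 * a) ^ (r + 1)\<bar> * (\<bar>R\<bar> ^ r * frob cov)"
    by (intro mult_left_mono) auto
  also have "\<dots> = \<tau> 0 * (2 * \<bar>a\<bar> * \<bar>R\<bar>) ^ r"
    by (simp add: \<tau>_0 abs_mult power_abs power_mult_distrib power2_eq_square)
  finally show ?thesis
    by (simp add: \<tau>_def abs_mult del: cov_power.simps)
qed

end

end

subsection \<open>Convergence in distribution from moments\<close>

text \<open>The moments of the standard normal law, in the recursive form that
  \<open>mixed_moment_Suc\<close> takes when \<open>\<tau> 0\<close> tends to 1 and everything of
  higher order vanishes.\<close>

fun normal_moment :: "nat \<Rightarrow> real" where
  "normal_moment 0 = 1"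
| "normal_moment (Suc 0) = 0"
| "normal_moment (Suc (Suc n)) = real (Suc n) * normal_moment n"

lemma std_normal_moment: "(LINT x|std_normal_distribution. x ^ n) = normal_moment n"
proof -
  have e: "(LINT x|std_normal_distribution. x ^ (2 * k)) = normal_moment (2 * k)" for k
  proof (induction k)
    case 0
    then show ?case using std_normal_distribution_even_moments[of 0] by simp
  next
    case (Suc k)
    have "(LINT x|std_normal_distribution. x ^ (2 * Suc k)) = fact (2 * Suc k) / (2 ^ Suc k * fact (Suc k))"
      by (rule std_normal_distribution_even_moments)
    also have "\<dots> = (real (2 * Suc k) * real (Suc (2 * k)) * fact (2 * k)) / (2 * 2 ^ k * (real (Suc k) * fact k))"
      by (simp add: algebra_simps)
    also have "\<dots> = real (Suc (2 * k)) * (fact (2 * k) / (2 ^ k * fact k))"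
      by (simp add: divide_simps)
    also have "fact (2 * k) / (2 ^ k * fact k) = normal_moment (2 * k)"
      using Suc std_normal_distribution_even_moments[of k] by simp
    finally show ?case by simp
  qed
  have o: "normal_moment (2 * k + 1) = 0" for k
    by (induction k) auto
  show ?thesis
  proof (cases "even n")
    case True
    then show ?thesis using e by (auto elim: evenE)
  next
    case False
    then show ?thesis using o integral_std_normal_distribution_moment_odd[of n] by (auto elim: oddE)
  qed
qed

lemma normal_moment_even_bound: "0 \<le> normal_moment (2 * k)" "normal_moment (2 * k) / fact (2 * k) = (1 / 2) ^ k / fact k"
proof -
  have *: "normal_moment (2 * k) = fact (2 * k) / (2 ^ k * fact k)"
    using std_normal_moment[of "2 * k"] std_normal_distribution_even_moments[of k] by simp
  show "0 \<le> normal_moment (2 * k)" "normal_moment (2 * k) / fact (2 * k) = (1 / 2) ^ k / fact k"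
    unfolding * by (simp_all add: power_divide)
qed

text \<open>Both characteristic functions are compared with Taylor polynomials of order
  \<open>2 k\<close>. For fixed \<open>k\<close> the polynomials converge to each other, and the
  remainders leave at most \<open>4 (t^2/2)^k / k!\<close> in the limit, which is arbitrarily small
  for large \<open>k\<close>.\<close>

lemma (in prob_space) char_conv_of_moments:
  fixes X :: "nat \<Rightarrow> 'a \<Rightarrow> real"
  assumes X: "eventually (\<lambda>n. all_moments (X n)) sequentially"
    and lim: "\<And>k. (\<lambda>n. expectation (\<lambda>\<omega>. X n \<omega> ^ k)) \<longlonglongrightarrow> normal_moment k"
  shows "(\<lambda>n. char (distr M borel (X n)) t) \<longlonglongrightarrow> char std_normal_distribution t"
proof -
  let ?c = "\<lambda>n. char (distr M borel (X n)) t" and ?z = "char std_normal_distribution t"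
  let ?m = "\<lambda>n k. expectation (\<lambda>\<omega>. X n \<omega> ^ k)"
  \<comment> \<open>The order \<open>2 * k\<close> is even so that the absolute moment in the Taylor
    remainder is an ordinary moment, whose limit is known.\<close>
  define B where "B k n = (\<Sum>j\<le>2 * k. \<bar>t\<bar> ^ j / fact j * \<bar>?m n j - normal_moment j\<bar>)
      + 2 * \<bar>t\<bar> ^ (2 * k) / fact (2 * k) * (?m n (2 * k) + normal_moment (2 * k))" for k n
  have bound: "cmod (?c n - ?z) \<le> B k n" if Xn: "all_moments (X n)" for n k
  proof -
    note I = all_moments_integrable all_moments_intros Xn
    have 1: "cmod (?c n - (\<Sum>j\<le>2 * k. ((\<i> * t) ^ j / fact j) * ?m n j)) \<le>
        (2 * \<bar>t\<bar> ^ (2 * k) / fact (2 * k)) * expectation (\<lambda>\<omega>. \<bar>X n \<omega>\<bar> ^ (2 * k))"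
      by (rule char_approx1') (auto intro!: I all_moments_measurable)
    have 2: "cmod (?z - (\<Sum>j\<le>2 * k. ((\<i> * t) ^ j / fact j) * normal_moment j)) \<le>
        (2 * \<bar>t\<bar> ^ (2 * k) / fact (2 * k)) * normal_moment (2 * k)"
      using real_distribution.char_approx1[of std_normal_distribution "2 * k" t, OF real_dist_normal_dist integrable_std_normal_distribution_moment]
      by (simp add: std_normal_moment power_even_abs)
    have 3: "cmod ((\<Sum>j\<le>2 * k. ((\<i> * t) ^ j / fact j) * ?m n j) - (\<Sum>j\<le>2 * k. ((\<i> * t) ^ j / fact j) * normal_moment j))
       \<le> (\<Sum>j\<le>2 * k. \<bar>t\<bar> ^ j / fact j * \<bar>?m n j - normal_moment j\<bar>)"
    proof -
      have "(\<Sum>j\<le>2 * k. ((\<i> * t) ^ j / fact j) * ?m n j) - (\<Sum>j\<le>2 * k. ((\<i> * t) ^ j / fact j) * normal_moment j)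
        = (\<Sum>j\<le>2 * k. ((\<i> * t) ^ j / fact j) * complex_of_real (?m n j - normal_moment j))"
        by (simp add: sum_subtractf[symmetric] right_diff_distrib)
      also have "cmod \<dots> \<le> (\<Sum>j\<le>2 * k. cmod (((\<i> * t) ^ j / fact j) * complex_of_real (?m n j - normal_moment j)))"
        by (rule norm_sum)
      also have "\<dots> = (\<Sum>j\<le>2 * k. \<bar>t\<bar> ^ j / fact j * \<bar>?m n j - normal_moment j\<bar>)"
        by (simp only: norm_mult norm_divide norm_power norm_of_real norm_fact norm_ii mult_1_left)
      finally show ?thesis .
    qed
    have "cmod (?c n - ?z) \<le> cmod (?c n - (\<Sum>j\<le>2 * k. ((\<i> * t) ^ j / fact j) * ?m n j))
      + cmod ((\<Sum>j\<le>2 * k. ((\<i> * t) ^ j / fact j) * ?m n j) - (\<Sum>j\<le>2 * k. ((\<i> * t) ^ j / fact j) * normal_moment j))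
      + cmod (?z - (\<Sum>j\<le>2 * k. ((\<i> * t) ^ j / fact j) * normal_moment j))"
      by norm
    then show ?thesis
      using 1 2 3 unfolding B_def by (simp add: power_even_abs distrib_left)
  qed
  have Blim: "(\<lambda>n. B k n) \<longlonglongrightarrow> 4 * ((t\<^sup>2 / 2) ^ k / fact k)" for k
  proof -
    have lim': "(\<lambda>n. B k n) \<longlonglongrightarrow> (\<Sum>j\<le>2 * k. \<bar>t\<bar> ^ j / fact j * \<bar>normal_moment j - normal_moment j\<bar>)
      + 2 * \<bar>t\<bar> ^ (2 * k) / fact (2 * k) * (normal_moment (2 * k) + normal_moment (2 * k))"
      (is "_ \<longlonglongrightarrow> ?l")
      unfolding B_def by (intro tendsto_intros lim)
    have "?l = 4 * \<bar>t\<bar> ^ (2 * k) * (normal_moment (2 * k) / fact (2 * k))"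
      by simp
    also have "\<dots> = 4 * ((t\<^sup>2 / 2) ^ k / fact k)"
      unfolding normal_moment_even_bound(2) by (simp add: power_mult power_divide)
    finally show ?thesis using lim' by simp
  qed
  show ?thesis
  proof (rule LIMSEQ_I)
    fix e :: real assume "e > 0"
    have "(\<lambda>k. 4 * ((t\<^sup>2 / 2) ^ k / fact k)) \<longlonglongrightarrow> 4 * 0"
      using summable_LIMSEQ_zero[OF summable_exp[of "t\<^sup>2 / 2"]]
      by (intro tendsto_intros) (simp add: field_simps)
    then have "eventually (\<lambda>k. 4 * ((t\<^sup>2 / 2) ^ k / fact k) < e) sequentially"
      using \<open>e > 0\<close> by (intro order_tendstoD) auto
    then obtain k where k: "4 * ((t\<^sup>2 / 2) ^ k / fact k) < e"
      by (auto simp: eventually_sequentially)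
    have "eventually (\<lambda>n. norm (?c n - ?z) < e) sequentially"
      using order_tendstoD(2)[OF Blim k] X
      by eventually_elim (use bound le_less_trans in blast)
    then show "\<exists>n0. \<forall>n\<ge>n0. norm (?c n - ?z) < e"
      by (simp add: eventually_sequentially)
  qed
qed

section \<open>A Slutsky argument for characteristic functions\<close>

lemma (in prob_space) expectation_Cauchy_Schwarz:
  fixes f g :: "'a \<Rightarrow> real"
  assumes [measurable]: "f \<in> borel_measurable M" "g \<in> borel_measurable M"
    and f: "integrable M (\<lambda>\<omega>. (f \<omega>)\<^sup>2)" and g: "integrable M (\<lambda>\<omega>. (g \<omega>)\<^sup>2)"
  shows "expectation (\<lambda>\<omega>. f \<omega> * g \<omega>) \<le> sqrt (expectation (\<lambda>\<omega>. (f \<omega>)\<^sup>2)) * sqrt (expectation (\<lambda>\<omega>. (g \<omega>)\<^sup>2))"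
proof -
  let ?A = "expectation (\<lambda>\<omega>. (f \<omega>)\<^sup>2)" and ?B = "expectation (\<lambda>\<omega>. (g \<omega>)\<^sup>2)"
    and ?C = "expectation (\<lambda>\<omega>. f \<omega> * g \<omega>)"
  have fg: "integrable M (\<lambda>\<omega>. f \<omega> * g \<omega>)"
  proof (rule Bochner_Integration.integrable_bound)
    show "integrable M (\<lambda>\<omega>. (f \<omega>)\<^sup>2 + (g \<omega>)\<^sup>2)"
      using f g by simp
    have "\<bar>x * y\<bar> \<le> x\<^sup>2 + y\<^sup>2" for x y :: real
      using sum_squares_bound[of "\<bar>x\<bar>" "\<bar>y\<bar>"] mult_nonneg_nonneg[OF abs_ge_zero[of x] abs_ge_zero[of y]]
      unfolding abs_mult power2_abs by linarith
    then show "AE \<omega> in M. norm (f \<omega> * g \<omega>) \<le> norm ((f \<omega>)\<^sup>2 + (g \<omega>)\<^sup>2)"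
      by auto
  qed measurable
  have nonneg: "0 \<le> ?A + 2 * x * ?C + x\<^sup>2 * ?B" for x
  proof -
    have "0 \<le> expectation (\<lambda>\<omega>. (f \<omega> + x * g \<omega>)\<^sup>2)"
      by (rule Bochner_Integration.integral_nonneg) simp
    also have "(\<lambda>\<omega>. (f \<omega> + x * g \<omega>)\<^sup>2) = (\<lambda>\<omega>. (f \<omega>)\<^sup>2 + 2 * x * (f \<omega> * g \<omega>) + x\<^sup>2 * (g \<omega>)\<^sup>2)"
      by (auto simp: power2_sum power_mult_distrib)
    also have "expectation \<dots> = ?A + 2 * x * ?C + x\<^sup>2 * ?B"
      using f g fg by simp
    finally show ?thesis .
  qed
  have "?C\<^sup>2 \<le> ?A * ?B"
  proof (cases "?B = 0")
    case True
    have "?C = 0"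
    proof (rule ccontr)
      assume "?C \<noteq> 0"
      \<comment> \<open>With \<open>?B = 0\<close> the quadratic is affine in \<open>x\<close>, and
        the chosen point gives it the value -1.\<close>
      then show False
        using nonneg[of "- (?A + 1) / (2 * ?C)"] True by (simp add: field_simps)
    qed
    then show ?thesis using True by simp
  next
    case False
    then have "?B > 0"
      using Bochner_Integration.integral_nonneg[of M "\<lambda>\<omega>. (g \<omega>)\<^sup>2"] by (simp add: less_le)
    then show ?thesis
      using nonneg[of "- ?C / ?B"] by (simp add: field_simps power2_eq_square)
  qed
  then have "?C \<le> sqrt (?A * ?B)"
    by (rule real_le_rsqrt)
  then show ?thesis by (simp add: real_sqrt_mult)
qed

text \<open>The factors \<open>B n\<close> converge almost surely but may have no moments. Their
  distance to 1 therefore enters truncated at 1, so that dominated convergence sends its second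
  moment to 0, while Cauchy-Schwarz and the bounded second moments of \<open>V n\<close> control the
  other factor.\<close>

lemma (in prob_space) char_conv_slutsky:
  fixes V B :: "nat \<Rightarrow> 'a \<Rightarrow> real"
  assumes V: "eventually (\<lambda>n. all_moments (V n)) sequentially"
    and V2: "eventually (\<lambda>n. expectation (\<lambda>\<omega>. (V n \<omega>)\<^sup>2) \<le> K) sequentially"
    and B[measurable]: "\<And>n. B n \<in> borel_measurable M"
    and B1: "AE \<omega> in M. (\<lambda>n. B n \<omega>) \<longlonglongrightarrow> 1"
    and lim: "(\<lambda>n. char (distr M borel (V n)) t) \<longlonglongrightarrow> z"
  shows "(\<lambda>n. char (distr M borel (\<lambda>\<omega>. B n \<omega> * V n \<omega>)) t) \<longlonglongrightarrow> z"
proof -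
  let ?d = "\<lambda>n \<omega>. min \<bar>B n \<omega> - 1\<bar> 1"
  \<comment> \<open>The constant comes from
    \<open>(|t| |V| + 2)^2 \<le> 2 t^2 V^2 + 8\<close>.\<close>
  define b where "b n = sqrt (2 * t\<^sup>2 * K + 8) * sqrt (expectation (\<lambda>\<omega>. (?d n \<omega>)\<^sup>2))" for n
  have bound: "cmod (char (distr M borel (\<lambda>\<omega>. B n \<omega> * V n \<omega>)) t - char (distr M borel (V n)) t) \<le> b n"
    if Vn: "all_moments (V n)" and V2n: "expectation (\<lambda>\<omega>. (V n \<omega>)\<^sup>2) \<le> K" for n
  proof -
    have [measurable]: "V n \<in> borel_measurable M"
      using Vn all_moments_measurable by blast
    note I = all_moments_integrable all_moments_intros Vn
    have pt: "cmod (iexp (t * (B n \<omega> * V n \<omega>)) - iexp (t * V n \<omega>)) \<le> (\<bar>t\<bar> * \<bar>V n \<omega>\<bar> + 2) * ?d n \<omega>" for \<omega>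
    proof (cases "\<bar>B n \<omega> - 1\<bar> \<le> 1")
      case True
      have "iexp (t * (B n \<omega> * V n \<omega>)) - iexp (t * V n \<omega>) = iexp (t * V n \<omega>) * (iexp (t * V n \<omega> * (B n \<omega> - 1)) - 1)"
        by (simp add: exp_add[symmetric] algebra_simps)
      then have "cmod (iexp (t * (B n \<omega> * V n \<omega>)) - iexp (t * V n \<omega>)) = cmod (iexp (t * V n \<omega> * (B n \<omega> - 1)) - 1)"
        by (simp add: norm_mult)
      also have "\<dots> \<le> \<bar>t * V n \<omega> * (B n \<omega> - 1)\<bar>"
        using iexp_approx1[of "t * V n \<omega> * (B n \<omega> - 1)" 0] by simp
      also have "\<dots> \<le> (\<bar>t\<bar> * \<bar>V n \<omega>\<bar> + 2) * ?d n \<omega>"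
        using True by (simp add: abs_mult distrib_right)
      finally show ?thesis .
    next
      case False
      have "cmod (iexp (t * (B n \<omega> * V n \<omega>)) - iexp (t * V n \<omega>)) \<le> 1 + 1"
        by (rule order_trans[OF norm_triangle_ineq4]) simp
      then show ?thesis using False by (simp add: add_increasing)
    qed
    have int_d2: "integrable M (\<lambda>\<omega>. (?d n \<omega>)\<^sup>2)"
      by (rule integrable_const_bound[of _ 1]) (auto simp: abs_le_square_iff[of _ 1, simplified, symmetric] power_le_one)
    have int_p: "integrable M (\<lambda>\<omega>. (\<bar>t\<bar> * \<bar>V n \<omega>\<bar> + 2)\<^sup>2)"
      by (intro I)
    have "char (distr M borel (\<lambda>\<omega>. B n \<omega> * V n \<omega>)) t - char (distr M borel (V n)) t
        = expectation (\<lambda>\<omega>. iexp (t * (B n \<omega> * V n \<omega>)) - iexp (t * V n \<omega>))"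
      unfolding char_def
      by (simp add: integral_distr, subst Bochner_Integration.integral_diff)
         (auto intro!: integrable_const_bound[of _ 1])
    also have "cmod \<dots> \<le> expectation (\<lambda>\<omega>. cmod (iexp (t * (B n \<omega> * V n \<omega>)) - iexp (t * V n \<omega>)))"
      by (rule integral_norm_bound)
    also have "\<dots> \<le> expectation (\<lambda>\<omega>. (\<bar>t\<bar> * \<bar>V n \<omega>\<bar> + 2) * ?d n \<omega>)"
    proof (rule integral_mono_AE')
      show "integrable M (\<lambda>\<omega>. (\<bar>t\<bar> * \<bar>V n \<omega>\<bar> + 2) * ?d n \<omega>)"
        by (rule Bochner_Integration.integrable_bound[OF int_p])
           (auto simp: abs_mult power2_eq_square intro!: mult_left_mono min.coboundedI2)
    qed (use pt in auto)
    also have "\<dots> \<le> sqrt (expectation (\<lambda>\<omega>. (\<bar>t\<bar> * \<bar>V n \<omega>\<bar> + 2)\<^sup>2)) * sqrt (expectation (\<lambda>\<omega>. (?d n \<omega>)\<^sup>2))"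
      by (rule expectation_Cauchy_Schwarz) (use int_p int_d2 in auto)
    also have "\<dots> \<le> b n"
      unfolding b_def
    proof (intro mult_right_mono real_sqrt_le_mono)
      have "expectation (\<lambda>\<omega>. (\<bar>t\<bar> * \<bar>V n \<omega>\<bar> + 2)\<^sup>2) \<le> expectation (\<lambda>\<omega>. 2 * t\<^sup>2 * (V n \<omega>)\<^sup>2 + 8)"
      proof (rule integral_mono[OF int_p])
        show "(\<bar>t\<bar> * \<bar>V n \<omega>\<bar> + 2)\<^sup>2 \<le> 2 * t\<^sup>2 * (V n \<omega>)\<^sup>2 + 8" for \<omega>
          using sum_squares_bound[of "\<bar>t\<bar> * \<bar>V n \<omega>\<bar>" 2] by (simp add: power2_sum power_mult_distrib)
      qed (intro I)
      also have "\<dots> = 2 * t\<^sup>2 * expectation (\<lambda>\<omega>. (V n \<omega>)\<^sup>2) + 8"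
        by (subst Bochner_Integration.integral_add) (auto intro!: I simp: prob_space)
      also have "\<dots> \<le> 2 * t\<^sup>2 * K + 8"
        using V2n by (simp add: mult_left_mono)
      finally show "expectation (\<lambda>\<omega>. (\<bar>t\<bar> * \<bar>V n \<omega>\<bar> + 2)\<^sup>2) \<le> 2 * t\<^sup>2 * K + 8" .
    qed auto
    finally show ?thesis .
  qed
  have "(\<lambda>n. expectation (\<lambda>\<omega>. (?d n \<omega>)\<^sup>2)) \<longlonglongrightarrow> expectation (\<lambda>\<omega>. 0)"
  proof (rule integral_dominated_convergence[where w = "\<lambda>_. 1"])
    show "AE \<omega> in M. (\<lambda>n. (?d n \<omega>)\<^sup>2) \<longlonglongrightarrow> 0"
      using B1
    proof eventually_elim
      case (elim \<omega>)
      have "(\<lambda>n. (?d n \<omega>)\<^sup>2) \<longlonglongrightarrow> (min \<bar>1 - 1\<bar> 1)\<^sup>2"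
        by (intro tendsto_intros elim)
      then show ?case by simp
    qed
  qed (auto simp: abs_le_square_iff[of _ 1, simplified, symmetric] power_le_one)
  then have "b \<longlonglongrightarrow> sqrt (2 * t\<^sup>2 * K + 8) * sqrt 0"
    unfolding b_def by (intro tendsto_intros) simp
  then have b0: "b \<longlonglongrightarrow> 0" by simp
  have "(\<lambda>n. char (distr M borel (\<lambda>\<omega>. B n \<omega> * V n \<omega>)) t - char (distr M borel (V n)) t) \<longlonglongrightarrow> 0"
    by (rule Lim_null_comparison[OF _ b0]) (use V V2 in eventually_elim, use bound in blast)
  from tendsto_add[OF this lim] show ?thesis by simp
qed

subsection \<open>Covariance of the wave solution\<close>

text \<open>The exceptional set \<open>S\<close> accommodates the singularity of the kernel on the
  diagonal and the kinks of the primitives. Working with nonnegative integrals gives integrability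
  and the value at once; the second claim is needed because \<open>ennreal\<close> truncates
  negative numbers.\<close>

lemma nn_integral_fundamental_theorem:
  fixes f F :: "real \<Rightarrow> real"
  assumes "finite S" "a \<le> b"
    and [measurable]: "f \<in> borel_measurable borel"
    and cont: "continuous_on {a..b} F"
    and deriv: "\<And>x. a < x \<Longrightarrow> x < b \<Longrightarrow> x \<notin> S \<Longrightarrow> (F has_real_derivative f x) (at x)"
    and nonneg: "\<And>x. a \<le> x \<Longrightarrow> x \<le> b \<Longrightarrow> 0 \<le> f x"
  shows "(\<integral>\<^sup>+x. ennreal (indicator {a..b} x * f x) \<partial>lborel) = ennreal (F b - F a)"
    and "0 \<le> F b - F a"
proof -
  have *: "(f has_integral (F b - F a)) {a..b}"
    by (rule fundamental_theorem_of_calculus_interior_strong[OF assms(1,2) _ cont])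
       (auto simp: has_real_derivative_iff_has_vector_derivative[symmetric] deriv)
  have "(\<lambda>x. indicator {a..b} x * f x) = (\<lambda>x. if x \<in> {a..b} then f x else 0)"
    by (auto simp: indicator_def)
  then have "((\<lambda>x. indicator {a..b} x * f x) has_integral (F b - F a)) UNIV"
    using * by (simp only: has_integral_restrict_UNIV)
  then show "(\<integral>\<^sup>+x. ennreal (indicator {a..b} x * f x) \<partial>lborel) = ennreal (F b - F a)"
    by (intro nn_integral_has_integral_lborel) (auto simp: indicator_def nonneg)
  show "0 \<le> F b - F a"
    by (rule has_integral_nonneg[OF *]) (use nonneg in auto)
qed

text \<open>This is \<open>sgn u * |u|^q\<close>. Written with \<open>max\<close>, it is visibly
  continuous across 0 for positive \<open>q\<close>.\<close>

definition signed_powr :: "real \<Rightarrow> real \<Rightarrow> real" where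
  "signed_powr q u = max 0 u powr q - max 0 (- u) powr q"

lemma continuous_on_max_powr:
  fixes f :: "real \<Rightarrow> real"
  assumes "q > 0" "continuous_on A f"
  shows "continuous_on A (\<lambda>u. max 0 (f u) powr q)"
  using assms by (intro continuous_on_powr' continuous_intros) auto

lemma continuous_on_signed_powr:
  fixes f :: "real \<Rightarrow> real"
  assumes "q > 0" "continuous_on A f"
  shows "continuous_on A (\<lambda>u. signed_powr q (f u))"
  unfolding signed_powr_def by (intro continuous_on_diff continuous_on_max_powr continuous_on_minus assms)

lemma signed_powr_has_derivative:
  assumes "u \<noteq> 0"
  shows "(signed_powr q has_real_derivative q * \<bar>u\<bar> powr (q - 1)) (at u)"
proof (cases "u > 0")
  case True
  have "((\<lambda>u. u powr q) has_real_derivative q * u powr (q - 1)) (at u)"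
    using True by (rule has_real_derivative_powr)
  then have "(signed_powr q has_real_derivative q * u powr (q - 1)) (at u)"
    by (rule has_field_derivative_transform_within_open[where S = "{0<..}"]) (use True in \<open>auto simp: signed_powr_def\<close>)
  then show ?thesis using True by simp
next
  case False
  have "((\<lambda>u. - ((- u) powr q)) has_real_derivative q * (- u) powr (q - 1)) (at u)"
    using False assms by (auto intro!: derivative_eq_intros)
  then have "(signed_powr q has_real_derivative q * (- u) powr (q - 1)) (at u)"
    by (rule has_field_derivative_transform_within_open[where S = "{..<0}"]) (use False assms in \<open>auto simp: signed_powr_def\<close>)
  then show ?thesis using False by simp
qed

lemma abs_powr_has_derivative:
  assumes "u \<noteq> 0"
  shows "((\<lambda>u. \<bar>u\<bar> powr q) has_real_derivative q * signed_powr (q - 1) u) (at u)"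
proof (cases "u > 0")
  case True
  have "((\<lambda>u. u powr q) has_real_derivative q * u powr (q - 1)) (at u)"
    using True by (rule has_real_derivative_powr)
  then have "((\<lambda>u. \<bar>u\<bar> powr q) has_real_derivative q * u powr (q - 1)) (at u)"
    by (rule has_field_derivative_transform_within_open[where S = "{0<..}"]) (use True in auto)
  then show ?thesis using True by (simp add: signed_powr_def)
next
  case False
  have "((\<lambda>u. (- u) powr q) has_real_derivative - (q * (- u) powr (q - 1))) (at u)"
    using False assms by (auto intro!: derivative_eq_intros)
  then have "((\<lambda>u. \<bar>u\<bar> powr q) has_real_derivative - (q * (- u) powr (q - 1))) (at u)"
    by (rule has_field_derivative_transform_within_open[where S = "{..<0}"]) (use False assms in auto)
  then show ?thesis using False by (simp add: signed_powr_def)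
qed

text \<open>The Hurst parameter is \<open>p / 2\<close>.\<close>

definition fbm_cov :: "real \<Rightarrow> real \<Rightarrow> real \<Rightarrow> real" where
  "fbm_cov p a b = (a powr p + b powr p - \<bar>a - b\<bar> powr p) / 2"

text \<open>For \<open>p = 2 H\<close> the noise kernel is the mixed second derivative of the
  fractional Brownian covariance. The fundamental theorem is applied twice: the kernel has a signed
  power of order \<open>p - 1\<close> as primitive, and that in turn an absolute power of order
  \<open>p\<close>.\<close>

lemma nn_integral_fbm_cov:
  fixes p a b :: real
  assumes "1 < p" "0 \<le> a" "0 \<le> b"
  shows "(\<integral>\<^sup>+r. \<integral>\<^sup>+v. ennreal (indicator {0..a} r * indicator {0..b} v * (p * (p - 1) / 2 * \<bar>r - v\<bar> powr (p - 2))) \<partial>lborel \<partial>lborel)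
     = ennreal (fbm_cov p a b)"
    and "0 \<le> fbm_cov p a b"
proof -
  define h where "h r = p / 2 * (signed_powr (p - 1) r - signed_powr (p - 1) (r - b))" for r
  have inner: "(\<integral>\<^sup>+v. ennreal (indicator {0..b} v * (p * (p - 1) / 2 * \<bar>r - v\<bar> powr (p - 2))) \<partial>lborel) = ennreal (h r)"
    and h_nonneg: "0 \<le> h r" for r
  proof -
    let ?F = "\<lambda>v. - (p / 2 * signed_powr (p - 1) (r - v))"
    have D: "(?F has_real_derivative p * (p - 1) / 2 * \<bar>r - v\<bar> powr (p - 2)) (at v)" if "v \<noteq> r" for v
    proof -
      have "((\<lambda>v. signed_powr (p - 1) (r - v)) has_real_derivative (p - 1) * \<bar>r - v\<bar> powr (p - 1 - 1) * (0 - 1)) (at v)"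
        by (rule DERIV_chain2[OF signed_powr_has_derivative]) (use that in \<open>auto intro!: derivative_eq_intros\<close>)
      then have "(?F has_real_derivative - (p / 2 * ((p - 1) * \<bar>r - v\<bar> powr (p - 1 - 1) * (0 - 1)))) (at v)"
        by (intro DERIV_minus DERIV_cmult)
      then show ?thesis by (simp add: mult.assoc)
    qed
    note * = nn_integral_fundamental_theorem[of "{r}" 0 b "\<lambda>v. p * (p - 1) / 2 * \<bar>r - v\<bar> powr (p - 2)" ?F]
    have C: "continuous_on {0..b} ?F"
      by (intro continuous_intros continuous_on_signed_powr) (use assms in auto)
    have e: "?F b - ?F 0 = h r"
      by (simp add: h_def right_diff_distrib)
    show "(\<integral>\<^sup>+v. ennreal (indicator {0..b} v * (p * (p - 1) / 2 * \<bar>r - v\<bar> powr (p - 2))) \<partial>lborel) = ennreal (h r)"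
      unfolding e[symmetric] by (rule *(1)) (use assms D C in auto)
    show "0 \<le> h r"
      unfolding e[symmetric] by (rule *(2)) (use assms D C in auto)
  qed
  let ?F = "\<lambda>r. (\<bar>r\<bar> powr p - \<bar>r - b\<bar> powr p) / 2"
  have D: "(?F has_real_derivative h r) (at r)" if "r \<notin> {0, b}" for r
  proof -
    have "((\<lambda>r. \<bar>r - b\<bar> powr p) has_real_derivative p * signed_powr (p - 1) (r - b) * (1 - 0)) (at r)"
      by (rule DERIV_chain2[OF abs_powr_has_derivative]) (use that in \<open>auto intro!: derivative_eq_intros\<close>)
    then have "(?F has_real_derivative (p * signed_powr (p - 1) r - p * signed_powr (p - 1) (r - b) * (1 - 0)) / 2) (at r)"
      by (intro DERIV_cdivide DERIV_diff abs_powr_has_derivative) (use that in auto)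
    then show ?thesis by (simp add: h_def right_diff_distrib diff_divide_distrib)
  qed
  have [measurable]: "h \<in> borel_measurable borel"
    unfolding h_def signed_powr_def by measurable
  note * = nn_integral_fundamental_theorem[of "{0, b}" 0 a h ?F]
  have C: "continuous_on {0..a} ?F"
    by (intro continuous_intros continuous_on_powr') (use assms in auto)
  have e: "?F a - ?F 0 = fbm_cov p a b"
    using assms by (simp add: fbm_cov_def add_divide_distrib diff_divide_distrib)
  have "(\<integral>\<^sup>+r. \<integral>\<^sup>+v. ennreal (indicator {0..a} r * indicator {0..b} v * (p * (p - 1) / 2 * \<bar>r - v\<bar> powr (p - 2))) \<partial>lborel \<partial>lborel)
    = (\<integral>\<^sup>+r. ennreal (indicator {0..a} r * h r) \<partial>lborel)"
  proof (rule nn_integral_cong)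
    fix r
    have "(\<integral>\<^sup>+v. ennreal (indicator {0..a} r * indicator {0..b} v * (p * (p - 1) / 2 * \<bar>r - v\<bar> powr (p - 2))) \<partial>lborel)
      = (\<integral>\<^sup>+v. ennreal (indicator {0..a} r) * ennreal (indicator {0..b} v * (p * (p - 1) / 2 * \<bar>r - v\<bar> powr (p - 2))) \<partial>lborel)"
      by (intro nn_integral_cong, subst ennreal_mult'[symmetric]) (simp_all add: mult.assoc)
    also have "\<dots> = ennreal (indicator {0..a} r) * ennreal (h r)"
      by (subst nn_integral_cmult, measurable) (simp only: inner)
    finally show "(\<integral>\<^sup>+v. ennreal (indicator {0..a} r * indicator {0..b} v * (p * (p - 1) / 2 * \<bar>r - v\<bar> powr (p - 2))) \<partial>lborel) = ennreal (indicator {0..a} r * h r)"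
      by (simp add: ennreal_mult')
  qed
  also have "\<dots> = ennreal (fbm_cov p a b)"
    unfolding e[symmetric] by (rule *(1)) (use assms D C h_nonneg in auto)
  finally show "(\<integral>\<^sup>+r. \<integral>\<^sup>+v. ennreal (indicator {0..a} r * indicator {0..b} v * (p * (p - 1) / 2 * \<bar>r - v\<bar> powr (p - 2))) \<partial>lborel \<partial>lborel)
     = ennreal (fbm_cov p a b)" .
  show "0 \<le> fbm_cov p a b"
    unfolding e[symmetric] by (rule *(2)) (use assms D C h_nonneg in auto)
qed

text \<open>The noise covariance integrates over space innermost, whereas the cones are easy to
  integrate over time first, with \<open>y\<close> fixed. Tonelli transfers the value computed in
  the second order to the first.\<close>

lemma nested_integral_3:
  fixes f :: "real \<times> real \<times> real \<Rightarrow> real"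
  assumes f[measurable]: "f \<in> borel_measurable borel" and nonneg: "\<And>z. 0 \<le> f z"
    and C: "0 \<le> C" "(\<integral>\<^sup>+y. \<integral>\<^sup>+r. \<integral>\<^sup>+v. ennreal (f (r, v, y)) \<partial>lborel \<partial>lborel \<partial>lborel) = ennreal C"
  shows "integrable lborel f"
    and "(LINT r|lborel. LINT v|lborel. LINT y|lborel. f (r, v, y)) = C"
proof -
  have m[measurable]: "f \<in> borel_measurable (lborel \<Otimes>\<^sub>M (lborel \<Otimes>\<^sub>M lborel))"
    by (simp add: lborel_prod)
  have "(\<integral>\<^sup>+z. ennreal (f z) \<partial>(lborel \<Otimes>\<^sub>M (lborel \<Otimes>\<^sub>M lborel)))
      = (\<integral>\<^sup>+r. \<integral>\<^sup>+w. ennreal (f (r, w)) \<partial>(lborel \<Otimes>\<^sub>M lborel) \<partial>lborel)"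
    by (subst sigma_finite_measure.nn_integral_fst[symmetric])
       (auto simp: lborel_prod sigma_finite_lborel)
  also have "\<dots> = (\<integral>\<^sup>+r. \<integral>\<^sup>+y. \<integral>\<^sup>+v. ennreal (f (r, v, y)) \<partial>lborel \<partial>lborel \<partial>lborel)"
    by (intro nn_integral_cong, subst lborel_pair.nn_integral_snd[symmetric]) auto
  also have "\<dots> = (\<integral>\<^sup>+y. \<integral>\<^sup>+r. \<integral>\<^sup>+v. ennreal (f (r, v, y)) \<partial>lborel \<partial>lborel \<partial>lborel)"
    by (rule lborel_pair.Fubini') measurable
  finally have nn: "(\<integral>\<^sup>+z. ennreal (f z) \<partial>(lborel \<Otimes>\<^sub>M (lborel \<Otimes>\<^sub>M lborel))) = ennreal C"
    using C by simp
  interpret P: pair_sigma_finite "lborel :: real measure" "lborel \<Otimes>\<^sub>M lborel :: (real \<times> real) measure"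
    unfolding lborel_prod by (intro pair_sigma_finite.intro sigma_finite_lborel)
  have int: "integrable (lborel \<Otimes>\<^sub>M (lborel \<Otimes>\<^sub>M lborel)) f"
    by (rule integrableI_nonneg) (use nn nonneg in auto)
  then show "integrable lborel f"
    by (simp add: lborel_prod)
  have "integral\<^sup>L (lborel \<Otimes>\<^sub>M (lborel \<Otimes>\<^sub>M lborel)) f = C"
    by (subst integral_eq_nn_integral) (use nn nonneg C in auto)
  also have "integral\<^sup>L (lborel \<Otimes>\<^sub>M (lborel \<Otimes>\<^sub>M lborel)) f =
      (LINT r|lborel. LINT w|(lborel \<Otimes>\<^sub>M lborel). f (r, w))"
    by (rule P.integral_fst'[symmetric, OF int])
  also have "\<dots> = (LINT r|lborel. LINT v|lborel. LINT y|lborel. f (r, v, y))"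
  proof (rule integral_cong_AE)
    \<comment> \<open>The slice at \<open>r\<close> is known to be integrable only for almost every
      \<open>r\<close>, so the inner Fubini step holds up to a null set.\<close>
    show "AE r in lborel. (LINT w|(lborel \<Otimes>\<^sub>M lborel). f (r, w)) = (LINT v|lborel. LINT y|lborel. f (r, v, y))"
      using P.AE_integrable_fst'[OF int]
      by eventually_elim (rule lborel_pair.integral_fst'[symmetric])
  qed measurable
  finally show "(LINT r|lborel. LINT v|lborel. LINT y|lborel. f (r, v, y)) = C" by simp
qed

lemma nested_integral_2:
  fixes f :: "real \<times> real \<Rightarrow> real"
  assumes f[measurable]: "f \<in> borel_measurable borel" and nonneg: "\<And>z. 0 \<le> f z"
    and C: "0 \<le> C" "(\<integral>\<^sup>+y. \<integral>\<^sup>+r. ennreal (f (r, y)) \<partial>lborel \<partial>lborel) = ennreal C"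
  shows "integrable lborel f"
    and "(LINT r|lborel. LINT y|lborel. f (r, y)) = C"
proof -
  have m[measurable]: "f \<in> borel_measurable (lborel \<Otimes>\<^sub>M lborel)"
    by (simp add: lborel_prod)
  have nn: "(\<integral>\<^sup>+z. ennreal (f z) \<partial>(lborel \<Otimes>\<^sub>M lborel)) = ennreal C"
    unfolding C(2)[symmetric] by (rule lborel_pair.nn_integral_snd[symmetric]) measurable
  have int: "integrable (lborel \<Otimes>\<^sub>M lborel) f"
    by (rule integrableI_nonneg) (use nn nonneg in auto)
  then show "integrable lborel f"
    by (simp add: lborel_prod)
  have "integral\<^sup>L (lborel \<Otimes>\<^sub>M lborel) f = C"
    by (subst integral_eq_nn_integral) (use nn nonneg C in auto)
  then show "(LINT r|lborel. LINT y|lborel. f (r, y)) = C"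
    using lborel_pair.integral_fst'[OF int] by simp
qed

text \<open>For \<open>p = 2 H\<close>, the covariance of \<open>u s x\<close> and \<open>u t x\<close> is \<open>wave_cov p s t / (4 * c)\<close>.\<close>

definition wave_cov :: "real \<Rightarrow> real \<Rightarrow> real \<Rightarrow> real" where
  "wave_cov p s t = (t powr (p + 1) + s powr (p + 1) - \<bar>t - s\<bar> powr (p + 1)) / (p + 1) - min s t * \<bar>t - s\<bar> powr p"

lemma wave_cov_commute: "wave_cov p s t = wave_cov p t s"
  by (simp add: wave_cov_def min.commute abs_minus_commute)

text \<open>The leading term \<open>2 s (t - s)^p\<close> fixes the scaling: over the grid of step
  \<open>1 / N\<close> these terms add up to about \<open>N^(1-p)\<close>.\<close>

lemma wave_cov_increment_variance:
  assumes "0 \<le> s" "s \<le> t"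
  shows "wave_cov p t t + wave_cov p s s - 2 * wave_cov p s t =
    2 * (t - s) powr (p + 1) / (p + 1) + 2 * s * (t - s) powr p"
  using assms by (simp add: wave_cov_def field_simps add_divide_distrib diff_divide_distrib)

context
  fixes p :: real
  assumes p: "1 \<le> p"
begin

lemma wave_cov_has_derivative:
  assumes "0 < s" "s < t"
  shows "((\<lambda>s. wave_cov p s t) has_real_derivative s powr p + s * p * (t - s) powr (p - 1)) (at s)"
proof -
  have "((\<lambda>s. (t powr (p + 1) + s powr (p + 1) - (t - s) powr (p + 1)) / (p + 1) - s * (t - s) powr p)
      has_real_derivative s powr p + s * p * (t - s) powr (p - 1)) (at s)"
  proof -
    have d: "((\<lambda>s. (t - s) powr q) has_real_derivative - (q * (t - s) powr (q - 1))) (at s)" for q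
      using assms by (auto intro!: derivative_eq_intros)
    have "((\<lambda>s. (t powr (p + 1) + s powr (p + 1) - (t - s) powr (p + 1)) / (p + 1) - s * (t - s) powr p)
      has_real_derivative (0 + (p + 1) * s powr (p + 1 - 1) - - ((p + 1) * (t - s) powr (p + 1 - 1))) / (p + 1)
        - (1 * (t - s) powr p + - (p * (t - s) powr (p - 1)) * s)) (at s)"
      using assms by (intro DERIV_diff DERIV_cdivide DERIV_add DERIV_const has_real_derivative_powr d DERIV_mult DERIV_ident)
    also have "(0 + (p + 1) * s powr (p + 1 - 1) - - ((p + 1) * (t - s) powr (p + 1 - 1))) / (p + 1) = s powr p + (t - s) powr p"
      using p by (simp add: add_divide_distrib)
    finally show ?thesis by (simp add: algebra_simps)
  qed
  then show ?thesis
  proof (rule has_field_derivative_transform_within_open[where S = "{0<..<t}"])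
  qed (use assms in \<open>auto simp: wave_cov_def min_def\<close>)
qed

lemma continuous_on_wave_cov: "A \<subseteq> {0..} \<Longrightarrow> continuous_on A (\<lambda>s. wave_cov p s t)"
  unfolding wave_cov_def using p
  by (intro continuous_on_diff continuous_on_divide continuous_on_add continuous_on_mult continuous_on_min
      continuous_on_powr' continuous_on_rabs continuous_on_const continuous_on_id) auto

text \<open>Since \<open>\<partial>\<^sub>s wave_cov p s t\<close> is nondecreasing in \<open>t > s\<close>, covariances of increments over
  disjoint intervals are nonnegative.\<close>

lemma wave_cov_increments_nonneg:
  assumes "0 \<le> s" "s \<le> s'" "s' \<le> t" "t \<le> t'"
  shows "0 \<le> wave_cov p s' t' - wave_cov p s t' - wave_cov p s' t + wave_cov p s t"
proof -
  have "wave_cov p s t' - wave_cov p s t \<le> wave_cov p s' t' - wave_cov p s' t"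
  proof (rule DERIV_nonneg_imp_increasing_open[OF assms(2)])
    fix y assume y: "s < y" "y < s'"
    show "\<exists>z. ((\<lambda>s. wave_cov p s t' - wave_cov p s t) has_real_derivative z) (at y) \<and> 0 \<le> z"
    proof (intro exI conjI)
      show "((\<lambda>s. wave_cov p s t' - wave_cov p s t) has_real_derivative
          (y powr p + y * p * (t' - y) powr (p - 1)) - (y powr p + y * p * (t - y) powr (p - 1))) (at y)"
        by (intro DERIV_diff wave_cov_has_derivative) (use assms y in auto)
      have "(t - y) powr (p - 1) \<le> (t' - y) powr (p - 1)"
        by (rule powr_mono2) (use assms y p in auto)
      then show "0 \<le> (y powr p + y * p * (t' - y) powr (p - 1)) - (y powr p + y * p * (t - y) powr (p - 1))"
        using assms y p by (simp add: mult_left_mono)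
    qed
  qed (use assms in \<open>auto intro!: continuous_intros continuous_on_wave_cov\<close>)
  then show ?thesis by simp
qed

text \<open>The derivative \<open>s^p + s p (1 - s)^(p-1)\<close> is at most \<open>1 + p\<close> on
  the unit interval. Only the time \<open>t = 1\<close> matters, since the row sums of the increment
  covariances telescope to it.\<close>

lemma wave_cov_lipschitz:
  assumes "0 \<le> s" "s \<le> s'" "s' \<le> 1"
  shows "wave_cov p s' 1 - wave_cov p s 1 \<le> (1 + p) * (s' - s)"
proof -
  have "(1 + p) * s - wave_cov p s 1 \<le> (1 + p) * s' - wave_cov p s' 1"
  proof (rule DERIV_nonneg_imp_increasing_open[OF assms(2)])
    fix y assume y: "s < y" "y < s'"
    show "\<exists>z. ((\<lambda>s. (1 + p) * s - wave_cov p s 1) has_real_derivative z) (at y) \<and> 0 \<le> z"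
    proof (intro exI conjI)
      show "((\<lambda>s. (1 + p) * s - wave_cov p s 1) has_real_derivative
          (1 + p) * 1 - (y powr p + y * p * (1 - y) powr (p - 1))) (at y)"
        by (intro DERIV_diff DERIV_cmult DERIV_ident wave_cov_has_derivative) (use assms y in auto)
      have "y powr p \<le> 1 powr p" "(1 - y) powr (p - 1) \<le> 1 powr (p - 1)"
        by (rule powr_mono2; use assms y p in simp)+
      moreover from this have "y * p * (1 - y) powr (p - 1) \<le> (1 * p) * 1"
        by (intro mult_mono) (use assms y p in auto)
      ultimately show "0 \<le> (1 + p) * 1 - (y powr p + y * p * (1 - y) powr (p - 1))"
        by simp
    qed
  qed (use assms in \<open>auto intro!: continuous_intros continuous_on_wave_cov\<close>)
  then show ?thesis by (simp add: algebra_simps)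
qed

end


section \<open>Noise covariances of backward cones\<close>

lemma indicator_backward_cone:
  assumes "c > 0"
  shows "indicat_real (backward_cone c t x) (r, y) = indicator {0..t - \<bar>y - x\<bar> / c} r"
  using assms by (auto simp: backward_cone_def indicator_def field_simps)
    (smt (verit) mult_nonneg_nonneg mult_less_cancel_left_pos abs_ge_zero)

lemma borel_measurable_backward_cone: "indicat_real (backward_cone c t x) \<in> borel_measurable borel"
proof -
  have "backward_cone c t x = {z. 0 \<le> fst z \<and> fst z \<le> t \<and> \<bar>snd z - x\<bar> \<le> c * (t - fst z)}"
    by (auto simp: backward_cone_def)
  moreover have "closed \<dots>"
    by (intro closed_Collect_conj closed_Collect_le continuous_intros)
  ultimately have "backward_cone c t x \<in> sets borel"
    by simp
  then show ?thesis by simp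
qed

text \<open>In the variable \<open>w = |y - x| / c\<close> the integrand is an explicit sum of
  powers with primitive \<open>K\<close>. Both halves of the base of the smaller cone contribute
  \<open>c * (K s - K 0)\<close>.\<close>

lemma nn_integral_cone_fbm_cov:
  fixes p c s t x :: real
  assumes p: "1 \<le> p" and c: "c > 0" and st: "0 \<le> s" "s \<le> t"
    and nonneg: "\<And>a b. 0 \<le> a \<Longrightarrow> 0 \<le> b \<Longrightarrow> 0 \<le> fbm_cov p a b"
  shows "(\<integral>\<^sup>+y. ennreal (indicator {x - c * s..x + c * s} y * fbm_cov p (s - \<bar>y - x\<bar> / c) (t - \<bar>y - x\<bar> / c)) \<partial>lborel)
      = ennreal (c * wave_cov p s t)"
    and "0 \<le> wave_cov p s t"
proof -
  define K where "K w = (- ((s - w) powr (p + 1) / (p + 1)) - (t - w) powr (p + 1) / (p + 1) - w * (t - s) powr p) / 2" for w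
  \<comment> \<open>The sign accounts for the decreasing branch left of \<open>x\<close>;
    subtracting \<open>K 0\<close> makes the two branches meet at \<open>x\<close>.\<close>
  define F where "F y = c * sgn (y - x) * (K (\<bar>y - x\<bar> / c) - K 0)" for y
  let ?f = "\<lambda>y. fbm_cov p (s - \<bar>y - x\<bar> / c) (t - \<bar>y - x\<bar> / c)"
  have dK: "(K has_real_derivative fbm_cov p (s - w) (t - w)) (at w)" if "w < s" for w
  proof -
    have d: "((\<lambda>w. - ((u - w) powr (p + 1) / (p + 1))) has_real_derivative (u - w) powr p) (at w)" if "w < u" for u
      using that p by (auto intro!: derivative_eq_intros)
    have "(K has_real_derivative ((s - w) powr p + (t - w) powr p - 1 * (t - s) powr p) / 2) (at w)"
      unfolding K_def[abs_def] diff_conv_add_uminus[of "- _" "_ / _"]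
      by (intro DERIV_cdivide DERIV_diff DERIV_add d DERIV_cmult_right DERIV_ident) (use that st in auto)
    then show ?thesis using st by (simp add: fbm_cov_def)
  qed
  have cK: "continuous_on {..s} K"
    unfolding K_def using p st
    by (intro continuous_on_diff continuous_on_divide continuous_on_minus continuous_on_mult
        continuous_on_powr' continuous_on_const continuous_on_id) auto
  have dF: "(F has_real_derivative ?f y) (at y)" if y: "x - c * s < y" "y < x + c * s" "y \<notin> {x}" for y
  proof -
    have w: "\<bar>y - x\<bar> / c < s"
      using y c by (auto simp: field_simps abs_if)
    consider "y > x" | "y < x" using y by fastforce
    then show ?thesis
    proof cases
      case 1
      have "((\<lambda>y. c * (K ((y - x) / c) - K 0)) has_real_derivative c * (fbm_cov p (s - (y - x) / c) (t - (y - x) / c) * ((1 - 0) / c) - 0)) (at y)"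
        by (intro DERIV_cmult DERIV_diff DERIV_const DERIV_chain2[OF dK] DERIV_cdivide DERIV_ident) (use w 1 in auto)
      then have "((\<lambda>y. c * (K ((y - x) / c) - K 0)) has_real_derivative ?f y) (at y)"
        using c 1 by simp
      then show ?thesis
        by (rule has_field_derivative_transform_within_open[where S = "{x<..}"]) (use 1 in \<open>auto simp: F_def\<close>)
    next
      case 2
      have "((\<lambda>y. - (c * (K ((x - y) / c) - K 0))) has_real_derivative - (c * (fbm_cov p (s - (x - y) / c) (t - (x - y) / c) * ((0 - 1) / c) - 0))) (at y)"
        by (intro DERIV_cmult DERIV_diff DERIV_const DERIV_chain2[OF dK] DERIV_cdivide DERIV_ident DERIV_minus) (use w 2 in auto)
      then have "((\<lambda>y. - (c * (K ((x - y) / c) - K 0))) has_real_derivative ?f y) (at y)"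
        using c 2 by simp
      then show ?thesis
        by (rule has_field_derivative_transform_within_open[where S = "{..<x}"]) (use 2 in \<open>auto simp: F_def\<close>)
    qed
  qed
  have cF: "continuous_on {x - c * s..x + c * s} F"
  proof -
    have 1: "continuous_on {x..x + c * s} F"
    proof -
      have "continuous_on {x..x + c * s} (\<lambda>y. c * (K ((y - x) / c) - K 0))"
        using c by (intro continuous_on_mult continuous_on_diff continuous_on_const continuous_on_compose2[OF cK] continuous_on_divide continuous_on_id)
          (auto simp: field_simps)
      then show ?thesis
        by (rule continuous_on_cong[THEN iffD1, rotated 2]) (auto simp: F_def sgn_if)
    qed
    have 2: "continuous_on {x - c * s..x} F"
    proof -
      have "continuous_on {x - c * s..x} (\<lambda>y. - (c * (K ((x - y) / c) - K 0)))"
        using c by (intro continuous_on_minus continuous_on_mult continuous_on_diff continuous_on_const continuous_on_compose2[OF cK] continuous_on_divide continuous_on_id)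
          (auto simp: field_simps)
      then show ?thesis
        by (rule continuous_on_cong[THEN iffD1, rotated 2]) (auto simp: F_def sgn_if)
    qed
    have "{x - c * s..x + c * s} = {x - c * s..x} \<union> {x..x + c * s}"
      using c st by (intro ivl_disj_un_two_touch(4)[symmetric]) auto
    then show ?thesis
      using 1 2 by (simp add: continuous_on_closed_Un)
  qed
  have [measurable]: "?f \<in> borel_measurable borel"
    unfolding fbm_cov_def by measurable
  have nn: "0 \<le> ?f y" if "x - c * s \<le> y" "y \<le> x + c * s" for y
  proof -
    have "\<bar>y - x\<bar> \<le> s * c"
      using that by (auto simp: abs_if algebra_simps)
    then have "\<bar>y - x\<bar> / c \<le> s"
      using c by (simp add: pos_divide_le_eq)
    then show ?thesis
      using st by (intro nonneg) simp_all
  qed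
  have e: "F (x + c * s) - F (x - c * s) = c * wave_cov p s t"
  proof (cases "s = 0")
    case True
    then show ?thesis using st p by (simp add: F_def wave_cov_def)
  next
    case False
    then have "F (x + c * s) - F (x - c * s) = c * (2 * (K s - K 0))"
      using c st by (simp add: F_def sgn_if mult_less_0_iff zero_less_mult_iff abs_mult)
    also have "2 * (K s - K 0) = wave_cov p s t"
    proof -
      have "2 * z / (p * 2 + 2) = z / (p + 1)" for z
        using p by (simp add: divide_simps)
      then show ?thesis
        using st by (simp add: K_def wave_cov_def add_divide_distrib diff_divide_distrib)
    qed
    finally show ?thesis by (simp add: mult.assoc mult.left_commute)
  qed
  note * = nn_integral_fundamental_theorem[of "{x}" "x - c * s" "x + c * s" ?f F]
  show "(\<integral>\<^sup>+y. ennreal (indicator {x - c * s..x + c * s} y * ?f y) \<partial>lborel) = ennreal (c * wave_cov p s t)"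
    unfolding e[symmetric] by (rule *(1)) (use c st cF dF nn in auto)
  have "0 \<le> c * wave_cov p s t"
    unfolding e[symmetric] by (rule *(2)) (use c st cF dF nn in auto)
  then show "0 \<le> wave_cov p s t"
    using c by (simp add: zero_le_mult_iff)
qed


lemma fbm_cov_1: "0 \<le> a \<Longrightarrow> 0 \<le> b \<Longrightarrow> fbm_cov 1 a b = min a b"
  by (simp add: fbm_cov_def min_def)

lemma fbm_cov_nonneg: "1 \<le> p \<Longrightarrow> 0 \<le> a \<Longrightarrow> 0 \<le> b \<Longrightarrow> 0 \<le> fbm_cov p a b"
  by (cases "p = 1") (auto simp: fbm_cov_1 intro: nn_integral_fbm_cov(2))

text \<open>At fixed \<open>y\<close> both regimes of the noise integrate over time to the same
  function \<open>fbm_cov (2 * H)\<close>, which is the minimum when \<open>H = 1/2\<close>; hence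
  one formula for all \<open>H\<close>. The constant \<open>H * (2 * H - 1)\<close> is kept inside
  the integrand to match the kernel of \<open>nn_integral_fbm_cov\<close>.\<close>

lemma backward_cone_integral:
  fixes H c s t x :: real
  assumes H: "1/2 \<le> H" and c: "c > 0" and st: "0 \<le> s" "s \<le> t"
  defines "f \<equiv> indicat_real (backward_cone c s x)" and "g \<equiv> indicat_real (backward_cone c t x)"
  shows "H = 1/2 \<Longrightarrow> integrable lborel (\<lambda>(r, y). f (r, y) * g (r, y))"
    and "H = 1/2 \<Longrightarrow> (LINT r|lborel. LINT y|lborel. f (r, y) * g (r, y)) = c * wave_cov (2 * H) s t"
    and "H \<noteq> 1/2 \<Longrightarrow> integrable lborel (\<lambda>(r, v, y). f (r, y) * g (v, y) * (H * (2 * H - 1) * \<bar>r - v\<bar> powr (2 * H - 2)))"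
    and "H \<noteq> 1/2 \<Longrightarrow> (LINT r|lborel. LINT v|lborel. LINT y|lborel. f (r, y) * g (v, y) * (H * (2 * H - 1) * \<bar>r - v\<bar> powr (2 * H - 2)))
       = c * wave_cov (2 * H) s t"
proof -
  have [measurable]: "f \<in> borel_measurable borel" "g \<in> borel_measurable borel"
    unfolding f_def g_def by (rule borel_measurable_backward_cone)+
  let ?a = "\<lambda>y. s - \<bar>y - x\<bar> / c" and ?b = "\<lambda>y. t - \<bar>y - x\<bar> / c"
  note fg = f_def g_def indicator_backward_cone[OF c]
  have p: "1 \<le> 2 * H" using H by simp
  have total: "(\<integral>\<^sup>+y. ennreal (indicator {x - c * s..x + c * s} y * fbm_cov (2 * H) (?a y) (?b y)) \<partial>lborel)
      = ennreal (c * wave_cov (2 * H) s t)" and "0 \<le> wave_cov (2 * H) s t"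
    by (rule nn_integral_cone_fbm_cov; use p c st fbm_cov_nonneg in simp)+
  have C: "0 \<le> c * wave_cov (2 * H) s t"
    using \<open>0 \<le> wave_cov (2 * H) s t\<close> c by simp
  have supp: "?a y < 0" if "y \<notin> {x - c * s..x + c * s}" for y
    using that c by (auto simp: field_simps abs_if)
  have pos: "0 \<le> ?a y" "0 \<le> ?b y" if "y \<in> {x - c * s..x + c * s}" for y
  proof -
    show "0 \<le> ?a y"
      using that c by (auto simp: field_simps abs_if)
    then show "0 \<le> ?b y" using st by simp
  qed
  {
    assume H2: "H = 1/2"
    have "(\<integral>\<^sup>+y. \<integral>\<^sup>+r. ennreal (case (r, y) of (r, y) \<Rightarrow> f (r, y) * g (r, y)) \<partial>lborel \<partial>lborel) =
      (\<integral>\<^sup>+y. ennreal (indicator {x - c * s..x + c * s} y * fbm_cov (2 * H) (?a y) (?b y)) \<partial>lborel)"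
    proof (rule nn_integral_cong)
      fix y
      show "(\<integral>\<^sup>+r. ennreal (case (r, y) of (r, y) \<Rightarrow> f (r, y) * g (r, y)) \<partial>lborel) =
        ennreal (indicator {x - c * s..x + c * s} y * fbm_cov (2 * H) (?a y) (?b y))"
      proof (cases "y \<in> {x - c * s..x + c * s}")
        case True
        have "(\<integral>\<^sup>+r. ennreal (case (r, y) of (r, y) \<Rightarrow> f (r, y) * g (r, y)) \<partial>lborel) =
          (\<integral>\<^sup>+r. indicator {0..?a y} r \<partial>lborel)"
          using st unfolding fg by (intro nn_integral_cong) (auto simp: indicator_def)
        also have "\<dots> = ennreal (?a y)"
          using pos[OF True] by simp
        finally show ?thesis
          using True pos[OF True] st by (simp add: H2 fbm_cov_1)
      next
        case False
        then show ?thesis using supp[OF False] by (simp add: fg)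
      qed
    qed
    note nn = trans[OF this total]
    have m: "(\<lambda>(r, y). f (r, y) * g (r, y)) \<in> borel_measurable borel"
      by (simp add: borel_prod[symmetric])
    have nonneg: "0 \<le> (case z of (r, y) \<Rightarrow> f (r, y) * g (r, y))" for z
      by (auto simp: f_def g_def)
    note * = nested_integral_2[OF m nonneg C nn]
    show "integrable lborel (\<lambda>(r, y). f (r, y) * g (r, y))"
      "(LINT r|lborel. LINT y|lborel. f (r, y) * g (r, y)) = c * wave_cov (2 * H) s t"
      using *(1) *(2)[unfolded prod.case] .
  }
  {
    assume H2: "H \<noteq> 1/2"
    let ?k = "\<lambda>r v. H * (2 * H - 1) * \<bar>r - v\<bar> powr (2 * H - 2)"
    have "(\<integral>\<^sup>+y. \<integral>\<^sup>+r. \<integral>\<^sup>+v. ennreal (case (r, v, y) of (r, v, y) \<Rightarrow> f (r, y) * g (v, y) * ?k r v) \<partial>lborel \<partial>lborel \<partial>lborel) =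
      (\<integral>\<^sup>+y. ennreal (indicator {x - c * s..x + c * s} y * fbm_cov (2 * H) (?a y) (?b y)) \<partial>lborel)"
    proof (rule nn_integral_cong)
      fix y
      show "(\<integral>\<^sup>+r. \<integral>\<^sup>+v. ennreal (case (r, v, y) of (r, v, y) \<Rightarrow> f (r, y) * g (v, y) * ?k r v) \<partial>lborel \<partial>lborel) =
        ennreal (indicator {x - c * s..x + c * s} y * fbm_cov (2 * H) (?a y) (?b y))"
      proof (cases "y \<in> {x - c * s..x + c * s}")
        case True
        then show ?thesis
          using nn_integral_fbm_cov(1)[of "2 * H" "?a y" "?b y"] pos[OF True] H H2 by (simp add: fg)
      next
        case False
        then show ?thesis using supp[OF False] by (simp add: fg)
      qed
    qed
    note nn = trans[OF this total]
    have m: "(\<lambda>(r, v, y). f (r, y) * g (v, y) * ?k r v) \<in> borel_measurable borel"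
      by (simp add: borel_prod[symmetric])
    have nonneg: "0 \<le> (case z of (r, v, y) \<Rightarrow> f (r, y) * g (v, y) * ?k r v)" for z
      using H by (auto simp: f_def g_def split: prod.splits)
    note * = nested_integral_3[OF m nonneg C nn]
    show "integrable lborel (\<lambda>(r, v, y). f (r, y) * g (v, y) * ?k r v)"
      "(LINT r|lborel. LINT v|lborel. LINT y|lborel. f (r, y) * g (v, y) * ?k r v) = c * wave_cov (2 * H) s t"
      using *(1) *(2)[unfolded prod.case] .
  }
qed

text \<open>Admissibility is the case \<open>s = t\<close> of the covariance integral. Cones lie in
  nonnegative time, so restricting the domain changes nothing, and the positive constant
  \<open>H * (2 * H - 1)\<close> is divided out.\<close>

lemma backward_cone_noise_integrand:
  assumes H: "1/2 \<le> H" and c: "c > 0" and t: "0 \<le> t"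
  shows "indicat_real (backward_cone c t x) \<in> noise_integrands H"
proof -
  let ?f = "indicat_real (backward_cone c t x)"
  have supp: "0 \<le> r" if "?f (r, y) \<noteq> 0" for r y
    using that by (auto simp: backward_cone_def indicator_def split: if_splits)
  show ?thesis
  proof (cases "H = 1/2")
    case True
    have "set_integrable lborel ({0..} \<times> UNIV) (\<lambda>(r, y). ?f (r, y) * ?f (r, y))"
      unfolding set_integrable_def
      by (rule Bochner_Integration.integrable_cong[THEN iffD1, OF refl _ backward_cone_integral(1)[OF H c t order_refl True, of x]])
         (auto simp: indicator_def[of "{0..} \<times> UNIV"] dest: supp)
    then show ?thesis
      using True by (simp add: noise_integrands_def borel_measurable_backward_cone)
  next
    case False
    have nz: "H * (2 * H - 1) \<noteq> 0" using H False by simp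
    have "integrable lborel (\<lambda>z. (case z of (r, v, y) \<Rightarrow> ?f (r, y) * ?f (v, y) * (H * (2 * H - 1) * \<bar>r - v\<bar> powr (2 * H - 2))) / (H * (2 * H - 1)))"
      using backward_cone_integral(3)[OF H c t order_refl False, of x] by (rule integrable_divide)
    then have "set_integrable lborel ({0..} \<times> {0..} \<times> UNIV) (\<lambda>(r, v, y). ?f (r, y) * ?f (v, y) * \<bar>r - v\<bar> powr (2 * H - 2))"
      unfolding set_integrable_def
      by (rule Bochner_Integration.integrable_cong[THEN iffD1, OF refl, rotated])
         (use nz in \<open>auto simp: indicator_def[of "{0..} \<times> {0..} \<times> UNIV"] dest: supp\<close>)
    then show ?thesis
      using False by (simp add: noise_integrands_def borel_measurable_backward_cone)
  qed
qed

lemma noise_cov_backward_cone: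
  assumes H: "1/2 \<le> H" and c: "c > 0" and st: "0 \<le> s" "s \<le> t"
  shows "noise_cov H (indicat_real (backward_cone c s x)) (indicat_real (backward_cone c t x)) = c * wave_cov (2 * H) s t"
proof -
  let ?f = "indicat_real (backward_cone c s x)" and ?g = "indicat_real (backward_cone c t x)"
  have zero: "?f (r, y) = 0" "?g (r, y) = 0" if "r < 0" for r y
    using that by (auto simp: backward_cone_def)
  show ?thesis
  proof (cases "H = 1/2")
    case True
    have "noise_cov H ?f ?g = (LINT r|lborel. LINT y|lborel. ?f (r, y) * ?g (r, y))"
      using True unfolding noise_cov_def set_lebesgue_integral_def
      by (auto intro!: Bochner_Integration.integral_cong simp: zero indicator_def[of "{0..}"] not_le)
    then show ?thesis
      using backward_cone_integral(2)[OF H c st True] by simp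
  next
    case False
    have 1: "indicator {0..} r *\<^sub>R (LINT v|lborel. indicator {0..} v *\<^sub>R (LINT y|lborel. ?f (r, y) * ?g (v, y) * \<bar>r - v\<bar> powr (2 * H - 2)))
      = (LINT v|lborel. LINT y|lborel. ?f (r, y) * ?g (v, y) * \<bar>r - v\<bar> powr (2 * H - 2))" for r
    proof (cases "r < 0")
      case False
      then show ?thesis
        by (auto intro!: Bochner_Integration.integral_cong simp: zero indicator_def[of "{0..}"] not_le)
    qed (simp add: zero)
    have "noise_cov H ?f ?g = H * (2 * H - 1) *
        (LINT r|lborel. LINT v|lborel. LINT y|lborel. ?f (r, y) * ?g (v, y) * \<bar>r - v\<bar> powr (2 * H - 2))"
      using False unfolding noise_cov_def set_lebesgue_integral_def 1 by simp
    also have "\<dots> = (LINT r|lborel. LINT v|lborel. LINT y|lborel. ?f (r, y) * ?g (v, y) * (H * (2 * H - 1) * \<bar>r - v\<bar> powr (2 * H - 2)))"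
      by (simp add: integral_mult_right_zero[symmetric] mult_ac del: integral_mult_right_zero)
    also have "\<dots> = c * wave_cov (2 * H) s t"
      by (rule backward_cone_integral(4)[OF H c st False])
    finally show ?thesis .
  qed
qed


section \<open>The covariance matrix of the increments on the grid\<close>

definition increment_cov :: "real \<Rightarrow> nat \<Rightarrow> nat \<Rightarrow> nat \<Rightarrow> real" where
  "increment_cov p N i j =
     wave_cov p (real (i + 1) / real N) (real (j + 1) / real N) - wave_cov p (real i / real N) (real (j + 1) / real N)
   - wave_cov p (real (i + 1) / real N) (real j / real N) + wave_cov p (real i / real N) (real j / real N)"

lemma increment_cov_commute: "increment_cov p N i j = increment_cov p N j i"
  unfolding increment_cov_def by (subst (1 2 3 4) wave_cov_commute) simp

lemma increment_cov_diag:
  assumes "N > 0"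
  shows "increment_cov p N i i = (1 / real N) powr p * (2 / (real N * (p + 1)) + 2 * real i / real N)"
proof -
  have h: "real (i + 1) / real N - real i / real N = 1 / real N"
    by (simp add: add_divide_distrib)
  have "increment_cov p N i i = 2 * (1 / real N) powr (p + 1) / (p + 1) + 2 * (real i / real N) * (1 / real N) powr p"
    using wave_cov_increment_variance[of "real i / real N" "real (i + 1) / real N" p]
    unfolding h increment_cov_def
    by (simp add: divide_right_mono wave_cov_commute[of p "real i / real N" "(1 + real i) / real N"] add.commute)
  also have "(1 / real N) powr (p + 1) = (1 / real N) powr p * (1 / real N)"
    using assms by (simp add: powr_add)
  finally show ?thesis by (simp add: algebra_simps)
qed

lemma increment_cov_nonneg:
  assumes "1 \<le> p" "N > 0" "i \<noteq> j"
  shows "0 \<le> increment_cov p N i j"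
proof -
  have *: "0 \<le> increment_cov p N i j" if "i < j" for i j
    unfolding increment_cov_def
    by (rule wave_cov_increments_nonneg) (use assms that in \<open>auto simp: divide_right_mono\<close>)
  show ?thesis
    using *[of i j] *[of j i] assms(3) increment_cov_commute[of p N i j] by (cases i j rule: linorder_cases) auto
qed

text \<open>A row sum is, up to a constant, the covariance of one increment with the whole path
  increment up to time 1. It telescopes, and \<open>wave_cov\<close> vanishes at time 0.\<close>

lemma increment_cov_row_sum:
  assumes "1 \<le> p" "i < N"
  shows "(\<Sum>j<N. increment_cov p N i j) \<le> (1 + p) / real N"
proof -
  define g where "g t = wave_cov p (real (i + 1) / real N) t - wave_cov p (real i / real N) t" for t
  have "(\<Sum>j<N. increment_cov p N i j) = (\<Sum>j<N. g (real (Suc j) / real N) - g (real j / real N))"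
    by (simp add: increment_cov_def g_def algebra_simps)
  also have "\<dots> = g (real N / real N) - g (real 0 / real N)"
    by (rule sum_lessThan_telescope)
  also have "\<dots> = wave_cov p (real (i + 1) / real N) 1 - wave_cov p (real i / real N) 1"
    using assms by (simp add: g_def wave_cov_def)
  also have "\<dots> \<le> (1 + p) * (real (i + 1) / real N - real i / real N)"
    by (rule wave_cov_lipschitz) (use assms in \<open>auto simp: divide_right_mono\<close>)
  also have "\<dots> = (1 + p) / real N"
    by (simp add: diff_divide_distrib[symmetric])
  finally show ?thesis .
qed

text \<open>The terms \<open>2 i / N\<close> of the diagonal sum to \<open>N - 1\<close>, which
  after scaling yields the limit 1; the rest is the bias of order \<open>1 / N\<close>.\<close>

lemma increment_cov_trace:
  assumes "N > 0"
  shows "real N powr (p - 1) * (\<Sum>i<N. increment_cov p N i i) = 1 + (2 / (p + 1) - 1) / real N"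
proof -
  have g: "2 * (\<Sum>i<N. real i) = real N * (real N - 1)"
    by (induction N) (auto simp: algebra_simps)
  have "(\<Sum>i<N. increment_cov p N i i) = (1 / real N) powr p * (\<Sum>i<N. 2 / (real N * (p + 1)) + 2 * real i / real N)"
    using assms by (simp add: increment_cov_diag sum_distrib_left)
  also have "(\<Sum>i<N. 2 / (real N * (p + 1)) + 2 * real i / real N) = real N * (2 / (real N * (p + 1))) + 2 * (\<Sum>i<N. real i) / real N"
    by (simp add: sum.distrib sum_divide_distrib sum_distrib_left)
  also have "\<dots> = 2 / (p + 1) + (real N - 1)"
    unfolding g using assms by simp
  finally have "(\<Sum>i<N. increment_cov p N i i) = (1 / real N) powr p * (2 / (p + 1) + (real N - 1))" .
  moreover have "real N powr (p - 1) * (1 / real N) powr p = 1 / real N"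
    using assms by (simp add: powr_diff powr_divide)
  ultimately have "real N powr (p - 1) * (\<Sum>i<N. increment_cov p N i i) = (1 / real N) * (2 / (p + 1) + (real N - 1))"
    by (simp only: mult.assoc[symmetric])
  then show ?thesis
    using assms by (simp add: field_simps)
qed

subsection \<open>Limit theorems for the quadratic variation\<close>

text \<open>The series of fourth powers has finite expectation, so it converges almost surely and
  its terms tend to 0.\<close>

lemma (in prob_space) AE_tendsto_0_of_summable_fourth_moment:
  assumes Q: "\<And>n. all_moments (Q n)"
    and s: "summable (\<lambda>n. expectation (\<lambda>\<omega>. Q n \<omega> ^ 4))"
  shows "AE \<omega> in M. (\<lambda>n. Q n \<omega>) \<longlonglongrightarrow> 0"
proof -
  note I = all_moments_integrable[OF all_moments_power[OF Q]]
  have [measurable]: "Q n \<in> borel_measurable M" for n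
    using Q all_moments_measurable by blast
  have "(\<integral>\<^sup>+\<omega>. (\<Sum>n. ennreal (Q n \<omega> ^ 4)) \<partial>M) = (\<Sum>n. \<integral>\<^sup>+\<omega>. ennreal (Q n \<omega> ^ 4) \<partial>M)"
    by (rule nn_integral_suminf) measurable
  also have "\<dots> = (\<Sum>n. ennreal (expectation (\<lambda>\<omega>. Q n \<omega> ^ 4)))"
    by (intro suminf_cong nn_integral_eq_integral I) (auto simp: zero_le_even_power)
  also have "\<dots> \<noteq> \<infinity>"
    using s by (subst suminf_ennreal2) (auto intro!: Bochner_Integration.integral_nonneg simp: zero_le_even_power)
  finally have "AE \<omega> in M. (\<Sum>n. ennreal (Q n \<omega> ^ 4)) \<noteq> \<infinity>"
    by (intro nn_integral_PInf_AE) auto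
  then show ?thesis
  proof eventually_elim
    case (elim \<omega>)
    have "summable (\<lambda>n. Q n \<omega> ^ 4)"
      by (rule summable_suminf_not_top) (use elim in \<open>auto simp: zero_le_even_power\<close>)
    then have "(\<lambda>n. Q n \<omega> ^ 4) \<longlonglongrightarrow> 0"
      by (rule summable_LIMSEQ_zero)
    then have "(\<lambda>n. sqrt (sqrt (Q n \<omega> ^ 4))) \<longlonglongrightarrow> sqrt (sqrt 0)"
      by (intro tendsto_real_sqrt)
    moreover have "sqrt (sqrt (q ^ 4)) = \<bar>q\<bar>" for q :: real
    proof -
      have "q ^ 4 = (q * q)\<^sup>2"
        by (simp only: power2_eq_square power4_eq_xxxx mult.assoc)
      then show ?thesis by simp
    qed
    ultimately have "(\<lambda>n. \<bar>Q n \<omega>\<bar>) \<longlonglongrightarrow> 0"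
      by (simp only: real_sqrt_zero)
    then show ?case by (simp add: tendsto_rabs_zero_iff)
  qed
qed

lemma (in prob_space) char_distr_shift:
  assumes [measurable]: "X \<in> borel_measurable M"
  shows "char (distr M borel (\<lambda>\<omega>. X \<omega> + e)) t = iexp (t * e) * char (distr M borel X) t"
proof -
  have "char (distr M borel (\<lambda>\<omega>. X \<omega> + e)) t = expectation (\<lambda>\<omega>. iexp (t * e) * iexp (t * X \<omega>))"
    unfolding char_def by (simp add: integral_distr exp_add[symmetric] algebra_simps)
  then show ?thesis
    unfolding char_def by (simp add: integral_distr)
qed

text \<open>Hypothesis \<open>a\<close> normalises the variance to 1, and \<open>aR\<close> sends
  every higher cumulant to 0 through \<open>\<tau>_bound\<close>. The limit of the moment recursion
  is then that of the normal moments.\<close>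

lemma (in gaussian_space) quadratic_moments_tendsto_normal:
  fixes D :: "nat \<Rightarrow> nat \<Rightarrow> 'a \<Rightarrow> real" and a R :: "nat \<Rightarrow> real"
  assumes D: "\<And>N i. D N i \<in> V"
    and R: "\<And>N i. i < N \<Longrightarrow> (\<Sum>j<N. \<bar>gaussian_vector.cov M (D N) i j\<bar>) \<le> R N"
    and a: "eventually (\<lambda>N. 2 * (a N)\<^sup>2 * gaussian_vector.frob N (gaussian_vector.cov M (D N)) = 1) sequentially"
    and aR: "(\<lambda>N. a N * R N) \<longlonglongrightarrow> 0"
  shows "(\<lambda>N. expectation (\<lambda>\<omega>. gaussian_vector.Q M (D N) N (a N) \<omega> ^ k)) \<longlonglongrightarrow> normal_moment k"
proof -
  interpret G: gaussian_vector M V "D N" N "a N" for N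
    by unfold_locales (rule D)
  have t0: "(\<lambda>N. G.\<tau> N 0) \<longlonglongrightarrow> 1"
    using a by (intro tendsto_eventually) (simp add: G.\<tau>_0)
  have tr: "(\<lambda>N. G.\<tau> N (Suc r)) \<longlonglongrightarrow> 0" for r
  proof (rule Lim_null_comparison)
    show "\<forall>\<^sub>F N in sequentially. norm (G.\<tau> N (Suc r)) \<le> G.\<tau> N 0 * (2 * \<bar>a N * R N\<bar>) ^ Suc r"
    proof (intro always_eventually allI)
      fix N
      show "norm (G.\<tau> N (Suc r)) \<le> G.\<tau> N 0 * (2 * \<bar>a N * R N\<bar>) ^ Suc r"
        using G.\<tau>_bound[OF R, of N "Suc r"] by (simp only: real_norm_def abs_mult mult.assoc)
    qed
    have "(\<lambda>N. G.\<tau> N 0 * (2 * \<bar>a N * R N\<bar>) ^ Suc r) \<longlonglongrightarrow> 1 * (2 * \<bar>0\<bar>) ^ Suc r"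
      by (intro tendsto_intros t0 aR)
    then show "(\<lambda>N. G.\<tau> N 0 * (2 * \<bar>a N * R N\<bar>) ^ Suc r) \<longlonglongrightarrow> 0" by simp
  qed
  \<comment> \<open>The recursion raises \<open>r\<close> while it lowers the exponent, so the
    induction has to control all mixed moments at once.\<close>
  have "(\<lambda>N. expectation (\<lambda>\<omega>. G.Q N \<omega> ^ k)) \<longlonglongrightarrow> normal_moment k \<and>
     (\<lambda>N. G.mixed_moment N 0 k) \<longlonglongrightarrow> normal_moment (Suc k) \<and> (\<forall>r. (\<lambda>N. G.mixed_moment N (Suc r) k) \<longlonglongrightarrow> 0)"
  proof (induction k)
    case 0
    then show ?case by (simp add: G.mixed_moment_0_right prob_space)
  next
    case (Suc k)
    have 1: "(\<lambda>N. real (Suc k) * (G.mixed_moment N (Suc 0) k + G.\<tau> N 0 * expectation (\<lambda>\<omega>. G.Q N \<omega> ^ k)))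
        \<longlonglongrightarrow> real (Suc k) * (0 + 1 * normal_moment k)"
      using Suc by (intro tendsto_intros t0) auto
    have 2: "(\<lambda>N. real (Suc k) * (G.mixed_moment N (Suc (Suc r)) k + G.\<tau> N (Suc r) * expectation (\<lambda>\<omega>. G.Q N \<omega> ^ k)))
        \<longlonglongrightarrow> real (Suc k) * (0 + 0 * normal_moment k)" for r
      using Suc by (intro tendsto_intros tr) auto
    have "(\<lambda>N. expectation (\<lambda>\<omega>. G.Q N \<omega> ^ Suc k)) \<longlonglongrightarrow> normal_moment (Suc k)"
      using Suc by (simp only: G.mixed_moment_0_left Suc_eq_plus1)
    moreover have "(\<lambda>N. G.mixed_moment N 0 (Suc k)) \<longlonglongrightarrow> normal_moment (Suc (Suc k))"
      using 1 by (simp only: G.mixed_moment_Suc normal_moment.simps add_0 mult_1)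
    moreover have "(\<lambda>N. G.mixed_moment N (Suc r) (Suc k)) \<longlonglongrightarrow> 0" for r
      using 2[of r] by (simp only: G.mixed_moment_Suc mult_zero_left mult_zero_right add_0)
    ultimately show ?case by blast
  qed
  then show ?thesis by blast
qed

text \<open>The deviation is taken as \<open>\<mu> - X N\<close> because the estimator decreases in
  \<open>X N\<close>; its error is then a positive multiple of this quantity where
  \<open>X N\<close> is positive. The moment clauses are what the Slutsky lemma asks for.\<close>

lemma (in gaussian_space) quadratic_variation_limits:
  fixes D :: "nat \<Rightarrow> nat \<Rightarrow> 'a \<Rightarrow> real" and p \<mu> :: real
  assumes D: "\<And>N i. D N i \<in> V" and p: "1 \<le> p" "p < 3/2" and \<mu>: "\<mu> > 0"
    and cov: "\<And>N i j. i < N \<Longrightarrow> j < N \<Longrightarrow> expectation (\<lambda>\<omega>. D N i \<omega> * D N j \<omega>) = \<mu> * increment_cov p N i j"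
  defines "X \<equiv> \<lambda>N \<omega>. real N powr (p - 1) * (\<Sum>i<N. (D N i \<omega>)\<^sup>2)"
  shows "AE \<omega> in M. (\<lambda>N. X N \<omega>) \<longlonglongrightarrow> \<mu>"
    and "\<exists>s. s \<longlonglongrightarrow> 0 \<and> eventually (\<lambda>N. s N > 0) sequentially \<and>
      eventually (\<lambda>N. all_moments (\<lambda>\<omega>. (\<mu> - X N \<omega>) / s N)) sequentially \<and>
      eventually (\<lambda>N. expectation (\<lambda>\<omega>. ((\<mu> - X N \<omega>) / s N)\<^sup>2) \<le> 4) sequentially \<and>
      (\<forall>t. (\<lambda>N. char (distr M borel (\<lambda>\<omega>. (\<mu> - X N \<omega>) / s N)) t) \<longlonglongrightarrow> char std_normal_distribution t)"
proof -
  define f where "f N = gaussian_vector.frob N (gaussian_vector.cov M (D N))" for N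
  \<comment> \<open>The exact standard deviation of \<open>X N\<close>, since the variance of
    \<open>Q\<close> is \<open>2 a^2\<close> times the squared Frobenius norm.\<close>
  define s where "s N = sqrt (2 * f N) * real N powr (p - 1)" for N
  interpret G: gaussian_vector M V "D N" N "real N powr (p - 1)" for N
    by unfold_locales (rule D)
  interpret G': gaussian_vector M V "D N" N "- (real N powr (p - 1) / s N)" for N
    by unfold_locales (rule D)
  have cov': "G.cov N i j = \<mu> * increment_cov p N i j" if "i < N" "j < N" for N i j
    unfolding G.cov_def using cov[OF that] .
  define R where "R N = \<mu> * (1 + p) / real N" for N
  define m where "m N = real N powr (p - 1) * (\<Sum>i<N. G.cov N i i)" for N

  have nonneg: "0 \<le> G.cov N i j" if "i < N" "j < N" for N i j
  proof (cases "i = j")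
    case True
    then show ?thesis by (simp add: G.cov_def Bochner_Integration.integral_nonneg)
  next
    case False
    then show ?thesis
      using increment_cov_nonneg[OF p(1), of N i j] \<mu> that by (simp add: cov'[OF that])
  qed
  have R: "(\<Sum>j<N. \<bar>G.cov N i j\<bar>) \<le> R N" if "i < N" for N i
  proof -
    have "(\<Sum>j<N. \<bar>G.cov N i j\<bar>) = \<mu> * (\<Sum>j<N. increment_cov p N i j)"
      using nonneg that by (simp add: cov'[symmetric] sum_distrib_left)
    also have "\<dots> \<le> \<mu> * ((1 + p) / real N)"
      by (intro mult_left_mono increment_cov_row_sum p that) (use \<mu> in auto)
    finally show ?thesis by (simp add: R_def)
  qed
  have m_eq: "m N = \<mu> + \<mu> * (2 / (p + 1) - 1) / real N" if "N > 0" for N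
  proof -
    have "m N = \<mu> * (real N powr (p - 1) * (\<Sum>i<N. increment_cov p N i i))"
      by (simp add: m_def cov' sum_distrib_left mult_ac)
    then show ?thesis
      unfolding increment_cov_trace[OF that] by (simp add: algebra_simps)
  qed
  have m_dist: "\<bar>\<mu> - m N\<bar> \<le> \<mu> / real N" if "N > 0" for N
  proof -
    have "\<bar>2 / (p + 1) - 1\<bar> \<le> 1"
      using p by (simp add: abs_le_iff divide_simps)
    then have "\<mu> / real N * \<bar>2 / (p + 1) - 1\<bar> \<le> \<mu> / real N * 1"
      using \<mu> by (intro mult_left_mono) auto
    moreover have "\<bar>\<mu> - m N\<bar> = \<mu> / real N * \<bar>2 / (p + 1) - 1\<bar>"
      using \<mu> by (simp add: m_eq[OF that] abs_mult)
    ultimately show ?thesis by simp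
  qed
  have m_lim: "m \<longlonglongrightarrow> \<mu>"
  proof -
    have "(\<lambda>N. \<mu> / real N) \<longlonglongrightarrow> 0"
      by (rule lim_const_over_n)
    then have "(\<lambda>N. m N - \<mu>) \<longlonglongrightarrow> 0"
      by (rule Lim_null_comparison[rotated])
         (use m_dist in \<open>auto simp: eventually_sequentially abs_minus_commute intro!: exI[of _ 1]\<close>)
    then show ?thesis by (simp add: LIM_zero_iff)
  qed
  have XQ: "X N \<omega> = G.Q N \<omega> + m N" for N \<omega>
    by (simp add: X_def G.Q_def m_def sum_subtractf algebra_simps)
  have VQ: "(\<mu> - X N \<omega>) / s N = G'.Q N \<omega> + (\<mu> - m N) / s N" for N \<omega>
    by (simp add: XQ G.Q_def G'.Q_def add_divide_distrib diff_divide_distrib)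

  \<comment> \<open>Cauchy-Schwarz for the trace, after discarding the off-diagonal entries: the
    mean itself bounds the variance from below.\<close>
  have f_lower: "m N ^ 2 \<le> real N * (real N powr (p - 1))\<^sup>2 * f N" for N
  proof -
    have "(\<Sum>i<N. G.cov N i i)\<^sup>2 \<le> real N * (\<Sum>i<N. (G.cov N i i)\<^sup>2)"
      using Cauchy_Schwarz_ineq_sum[of "\<lambda>_. 1" "\<lambda>i. G.cov N i i" "{..<N}"] by simp
    also have "(\<Sum>i<N. (G.cov N i i)\<^sup>2) \<le> f N"
      unfolding f_def G.frob_def
    proof (rule sum_mono)
      fix i assume "i \<in> {..<N}"
      then show "(G.cov N i i)\<^sup>2 \<le> (\<Sum>j<N. (G.cov N i j)\<^sup>2)"
        by (intro member_le_sum[of i "{..<N}" "\<lambda>j. (G.cov N i j)\<^sup>2"]) auto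
    qed
    finally have "(\<Sum>i<N. G.cov N i i)\<^sup>2 \<le> real N * f N"
      by (simp add: mult_left_mono)
    then have "(real N powr (p - 1))\<^sup>2 * (\<Sum>i<N. G.cov N i i)\<^sup>2 \<le> (real N powr (p - 1))\<^sup>2 * (real N * f N)"
      by (rule mult_left_mono) simp
    then show ?thesis
      by (simp add: m_def power_mult_distrib mult_ac)
  qed
  have f_nonneg: "0 \<le> f N" for N
    by (auto simp: f_def G.frob_def intro!: sum_nonneg)
  have s_sq: "(s N)\<^sup>2 = 2 * (real N powr (p - 1))\<^sup>2 * f N" for N
    using f_nonneg by (simp add: s_def power_mult_distrib)
  have s_nonneg: "0 \<le> s N" for N
    using f_nonneg by (simp add: s_def)
  \<comment> \<open>From \<open>N = 2\<close> on, the bias is at most half of \<open>\<mu>\<close>,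
    so \<open>m N\<close> stays above \<open>\<mu> / 2\<close>.\<close>
  have s_lower: "\<mu> / sqrt (2 * real N) \<le> s N" if "N \<ge> 2" for N
  proof -
    have "\<mu> / real N \<le> \<mu> / 2"
      using that \<mu> by (intro divide_left_mono) auto
    then have "\<mu> / 2 \<le> m N"
      using m_dist[of N] that by linarith
    then have "(\<mu> / 2)\<^sup>2 \<le> (m N)\<^sup>2"
      using \<mu> by (intro power_mono) auto
    also have "\<dots> \<le> real N * (s N)\<^sup>2 / 2"
      using f_lower[of N] by (simp add: s_sq)
    finally have "\<mu>\<^sup>2 \<le> (s N)\<^sup>2 * (2 * real N)"
      by (simp add: power_divide mult_ac)
    then have "(\<mu> / sqrt (2 * real N))\<^sup>2 \<le> (s N)\<^sup>2"
      using that by (simp add: power_divide divide_le_eq)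
    then show ?thesis
      using s_nonneg by (rule power2_le_imp_le)
  qed
  have s_pos: "s N > 0" if "N \<ge> 2" for N
    using s_lower[OF that] that \<mu> by (intro less_le_trans[OF _ s_lower[OF that]]) auto

  \<comment> \<open>Each entry is at most the mean of two diagonal entries, and the bracket in
    \<open>increment_cov_diag\<close> is at most \<open>2 + 2\<close>.\<close>
  have cov_le: "G.cov N i j \<le> 4 * \<mu> * real N powr - p" if "i < N" "j < N" for N i j
  proof -
    have diag: "G.cov N i i \<le> 4 * \<mu> * real N powr - p" if "i < N" for i
    proof -
      have "2 / (real N * (p + 1)) \<le> 2 / 1"
        using p that by (intro divide_left_mono) (auto simp: mult_ge1_I)
      moreover have "2 * real i / real N \<le> 2"
        using that by (simp add: divide_le_eq)
      ultimately have "increment_cov p N i i \<le> (1 / real N) powr p * 4"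
        using that by (subst increment_cov_diag) (auto intro!: mult_left_mono)
      also have "(1 / real N) powr p = real N powr - p"
        using that by (simp add: powr_divide powr_minus_divide)
      finally show ?thesis
        using \<mu> that by (simp add: cov' mult_ac)
    qed
    have "G.cov N i j \<le> expectation (\<lambda>\<omega>. 1/2 * (D N i \<omega> * D N i \<omega> + D N j \<omega> * D N j \<omega>))"
      unfolding G.cov_def
    proof (rule integral_mono)
      show "D N i \<omega> * D N j \<omega> \<le> 1/2 * (D N i \<omega> * D N i \<omega> + D N j \<omega> * D N j \<omega>)" for \<omega>
        using sum_squares_bound[of "D N i \<omega>" "D N j \<omega>"] by (simp add: power2_eq_square)
    qed (intro all_moments_integrable all_moments_intros G.all_moments_D)+
    also have "\<dots> = 1/2 * expectation (\<lambda>\<omega>. D N i \<omega> * D N i \<omega> + D N j \<omega> * D N j \<omega>)"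
      by (rule integral_mult_right_zero)
    also have "expectation (\<lambda>\<omega>. D N i \<omega> * D N i \<omega> + D N j \<omega> * D N j \<omega>) = G.cov N i i + G.cov N j j"
      unfolding G.cov_def
      by (intro Bochner_Integration.integral_add all_moments_integrable all_moments_intros G.all_moments_D)
    also have "1/2 * (G.cov N i i + G.cov N j j) \<le> 4 * \<mu> * real N powr - p"
      using diag[OF that(1)] diag[OF that(2)] by simp
    finally show ?thesis .
  qed
  \<comment> \<open>The sum of squares is at most the largest entry times the sum of all entries,
    and the latter is at most \<open>N * R N\<close>.\<close>
  have f_upper: "f N \<le> 4 * \<mu>\<^sup>2 * (1 + p) * real N powr - p" for N
  proof (cases "N = 0")
    case False
    have "f N \<le> (\<Sum>i<N. \<Sum>j<N. (4 * \<mu> * real N powr - p) * \<bar>G.cov N i j\<bar>)"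
      unfolding f_def G.frob_def power2_eq_square
      by (intro sum_mono) (use nonneg cov_le in \<open>auto intro!: mult_right_mono\<close>)
    also have "\<dots> = (4 * \<mu> * real N powr - p) * (\<Sum>i<N. \<Sum>j<N. \<bar>G.cov N i j\<bar>)"
      by (simp add: sum_distrib_left)
    also have "\<dots> \<le> (4 * \<mu> * real N powr - p) * (\<Sum>i<N. R N)"
      by (intro mult_left_mono sum_mono R) (use \<mu> in auto)
    also have "\<dots> = 4 * \<mu>\<^sup>2 * (1 + p) * real N powr - p"
      using False by (simp add: R_def power2_eq_square)
    finally show ?thesis .
  qed (simp add: f_def G.frob_def)
  have s_upper: "(s N)\<^sup>2 \<le> 8 * \<mu>\<^sup>2 * (1 + p) * real N powr (p - 2)" for N
  proof (cases "N = 0")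
    case False
    have "(s N)\<^sup>2 \<le> 2 * (real N powr (p - 1))\<^sup>2 * (4 * \<mu>\<^sup>2 * (1 + p) * real N powr - p)"
      unfolding s_sq by (intro mult_left_mono f_upper) auto
    also have "\<dots> = 8 * \<mu>\<^sup>2 * (1 + p) * (real N powr (p - 1) * real N powr (p - 1) * real N powr - p)"
      by (simp add: power2_eq_square)
    also have "real N powr (p - 1) * real N powr (p - 1) * real N powr - p = real N powr (p - 2)"
      by (simp add: powr_add[symmetric])
    finally show ?thesis .
  qed (simp add: s_def)
  have s_lim: "s \<longlonglongrightarrow> 0"
  proof -
    have "(\<lambda>N. real N powr (p - 2)) \<longlonglongrightarrow> 0"
      by (rule tendsto_neg_powr[OF _ filterlim_real_sequentially]) (use p in auto)
    then have "(\<lambda>N. 8 * \<mu>\<^sup>2 * (1 + p) * real N powr (p - 2)) \<longlonglongrightarrow> 8 * \<mu>\<^sup>2 * (1 + p) * 0"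
      by (rule tendsto_mult_left)
    then have *: "(\<lambda>N. 8 * \<mu>\<^sup>2 * (1 + p) * real N powr (p - 2)) \<longlonglongrightarrow> 0"
      by (simp only: mult_zero_right)
    have "(\<lambda>N. (s N)\<^sup>2) \<longlonglongrightarrow> 0"
      by (rule Lim_null_comparison[OF _ *], rule always_eventually) (simp only: real_norm_def abs_power2 s_upper simp_thms)
    then have "(\<lambda>N. sqrt ((s N)\<^sup>2)) \<longlonglongrightarrow> sqrt 0"
      by (rule tendsto_real_sqrt)
    then show ?thesis using s_nonneg by simp
  qed

  \<comment> \<open>The constants are \<open>192 = 3 * 64\<close> from the squared variance and
    \<open>192 = 6 * 32\<close> from the fourth cumulant, where one of three factors
    \<open>N^(p-2)\<close> is bounded by 1.\<close>
  have fourth: "expectation (\<lambda>\<omega>. G.Q N \<omega> ^ 4) \<le> (192 * \<mu> ^ 4 * (1 + p)\<^sup>2 + 192 * \<mu> ^ 4 * (1 + p) ^ 3) * real N powr (2 * p - 4)" for N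
  proof (cases "N = 0")
    case False
    let ?n = "real N powr (p - 2)"
    have \<tau>0: "G.\<tau> N 0 = (s N)\<^sup>2"
      by (simp add: G.\<tau>_0 s_sq f_def)
    have n2: "?n\<^sup>2 = real N powr (2 * p - 4)"
      by (simp add: power2_eq_square powr_add[symmetric])
    have n1: "?n \<le> 1"
      using powr_mono[of "p - 2" 0 "real N"] False p by simp
    have aR: "(2 * \<bar>real N powr (p - 1)\<bar> * \<bar>R N\<bar>) = 2 * \<mu> * (1 + p) * ?n"
      using \<mu> p False by (simp add: R_def powr_diff abs_mult field_simps power2_eq_square)
    have alg: "(8 * x\<^sup>2 * q * n)\<^sup>2 = 64 * x ^ 4 * q\<^sup>2 * n\<^sup>2"
      "(8 * x\<^sup>2 * q * 1) * (2 * x * q * n)\<^sup>2 = 32 * x ^ 4 * q ^ 3 * n\<^sup>2" for x q n :: real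
      by (simp_all add: power2_eq_square power3_eq_cube power4_eq_xxxx)
    have "(G.\<tau> N 0)\<^sup>2 \<le> (8 * \<mu>\<^sup>2 * (1 + p) * ?n)\<^sup>2"
      unfolding \<tau>0 by (rule power_mono[OF s_upper]) simp
    also have "\<dots> = 64 * \<mu> ^ 4 * (1 + p)\<^sup>2 * ?n\<^sup>2"
      by (rule alg(1))
    finally have 1: "(G.\<tau> N 0)\<^sup>2 \<le> 64 * \<mu> ^ 4 * (1 + p)\<^sup>2 * ?n\<^sup>2" .
    have "G.\<tau> N 2 \<le> G.\<tau> N 0 * (2 * \<mu> * (1 + p) * ?n)\<^sup>2"
      using G.\<tau>_bound[OF R, of N 2] unfolding aR by simp
    also have "\<dots> \<le> (8 * \<mu>\<^sup>2 * (1 + p) * 1) * (2 * \<mu> * (1 + p) * ?n)\<^sup>2"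
    proof (intro mult_right_mono)
      have "8 * \<mu>\<^sup>2 * (1 + p) * ?n \<le> 8 * \<mu>\<^sup>2 * (1 + p) * 1"
        using p by (intro mult_left_mono n1) auto
      then show "G.\<tau> N 0 \<le> 8 * \<mu>\<^sup>2 * (1 + p) * 1"
        unfolding \<tau>0 using s_upper[of N] by linarith
    qed simp
    also have "\<dots> = 32 * \<mu> ^ 4 * (1 + p) ^ 3 * ?n\<^sup>2"
      by (rule alg(2))
    finally have 2: "G.\<tau> N 2 \<le> 32 * \<mu> ^ 4 * (1 + p) ^ 3 * ?n\<^sup>2" .
    show ?thesis
      using 1 2 unfolding G.expectation_Q_power_4 n2[symmetric] distrib_right by linarith
  next
    case True
    have "G.Q N \<omega> = 0" for \<omega>
      unfolding G.Q_def using True by simp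
    then show ?thesis using True by simp
  qed
  \<comment> \<open>The variance bound \<open>N^(p-2)\<close> is not summable for
    \<open>p \<ge> 1\<close>, which is why fourth moments are used; \<open>2 p - 4 < -1\<close> is
    the condition \<open>p < 3/2\<close>.\<close>
  have "summable (\<lambda>N. expectation (\<lambda>\<omega>. G.Q N \<omega> ^ 4))"
  proof (rule summable_comparison_test')
    show "summable (\<lambda>N. (192 * \<mu> ^ 4 * (1 + p)\<^sup>2 + 192 * \<mu> ^ 4 * (1 + p) ^ 3) * real N powr (2 * p - 4))"
      using p by (intro summable_mult) (simp add: summable_real_powr_iff)
    show "norm (expectation (\<lambda>\<omega>. G.Q N \<omega> ^ 4)) \<le> (192 * \<mu> ^ 4 * (1 + p)\<^sup>2 + 192 * \<mu> ^ 4 * (1 + p) ^ 3) * real N powr (2 * p - 4)"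
      if "N \<ge> 0" for N
      using fourth[of N] Bochner_Integration.integral_nonneg[of M "\<lambda>\<omega>. G.Q N \<omega> ^ 4"]
      by (simp add: zero_le_even_power)
  qed
  then have "AE \<omega> in M. (\<lambda>N. G.Q N \<omega>) \<longlonglongrightarrow> 0"
    by (rule AE_tendsto_0_of_summable_fourth_moment[OF G.all_moments_Q])
  then show "AE \<omega> in M. (\<lambda>N. X N \<omega>) \<longlonglongrightarrow> \<mu>"
  proof eventually_elim
    case (elim \<omega>)
    then show ?case
      unfolding XQ using tendsto_add[OF elim m_lim] by simp
  qed

  \<comment> \<open>The bias in units of the standard deviation: \<open>O(1 / N)\<close> against at
    least a multiple of \<open>N^(-1/2)\<close>.\<close>
  define e where "e N = (\<mu> - m N) / s N" for N
  have e_lim: "e \<longlonglongrightarrow> 0"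
  proof (rule Lim_null_comparison)
    show "\<forall>\<^sub>F N in sequentially. norm (e N) \<le> sqrt 2 * (1 / sqrt (real N))"
      using eventually_ge_at_top[of 2]
    proof eventually_elim
      case (elim N)
      have "\<bar>\<mu> - m N\<bar> \<le> \<mu> / real N"
        using m_dist elim by simp
      then have "\<bar>\<mu> - m N\<bar> / s N \<le> (\<mu> / real N) / (\<mu> / sqrt (2 * real N))"
        by (intro frac_le s_lower) (use elim \<mu> in auto)
      moreover have "norm (e N) = \<bar>\<mu> - m N\<bar> / s N"
        using s_nonneg by (simp add: e_def)
      ultimately have "norm (e N) \<le> (\<mu> / real N) / (\<mu> / sqrt (2 * real N))"
        by simp
      also have "\<dots> = sqrt 2 * (sqrt (real N) / real N)"
        using \<mu> by (simp add: real_sqrt_mult)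
      also have "sqrt (real N) / real N = 1 / sqrt (real N)"
        using elim by (simp add: field_simps)
      finally show ?case .
    qed
    have "(\<lambda>N. 1 / sqrt (real N)) \<longlonglongrightarrow> 0"
    proof (rule Lim_transform_eventually)
      show "(\<lambda>N. real N powr - (1/2)) \<longlonglongrightarrow> 0"
        by (rule tendsto_neg_powr[OF _ filterlim_real_sequentially]) auto
      show "\<forall>\<^sub>F N in sequentially. real N powr - (1/2) = 1 / sqrt (real N)"
        by (simp add: powr_minus_divide powr_half_sqrt)
    qed
    then have "(\<lambda>N. sqrt 2 * (1 / sqrt (real N))) \<longlonglongrightarrow> sqrt 2 * 0"
      by (rule tendsto_mult_left)
    then show "(\<lambda>N. sqrt 2 * (1 / sqrt (real N))) \<longlonglongrightarrow> 0" by simp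
  qed
  have unit: "2 * (- (real N powr (p - 1) / s N))\<^sup>2 * f N = 1" if "N \<ge> 2" for N
  proof -
    have "2 * (- (real N powr (p - 1) / s N))\<^sup>2 * f N = (s N)\<^sup>2 / (s N)\<^sup>2"
      unfolding s_sq power2_minus power_divide by simp
    then show ?thesis
      using s_pos[OF that] by simp
  qed
  have moments: "(\<lambda>N. expectation (\<lambda>\<omega>. G'.Q N \<omega> ^ k)) \<longlonglongrightarrow> normal_moment k" for k
  proof (rule quadratic_moments_tendsto_normal[OF D R])
    show "\<forall>\<^sub>F N in sequentially. 2 * (- (real N powr (p - 1) / s N))\<^sup>2 * G.frob N (G.cov N) = 1"
      using eventually_ge_at_top[of 2] by eventually_elim (use unit in \<open>simp add: f_def\<close>)
    show "(\<lambda>N. - (real N powr (p - 1) / s N) * R N) \<longlonglongrightarrow> 0"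
    proof (rule Lim_null_comparison)
      \<comment> \<open>Inserting \<open>s_lower\<close> and \<open>R N = O(1 / N)\<close> gives the
        exponent \<open>p - 1 + 1/2 - 1\<close>; its negativity is where the central limit theorem
        uses \<open>p < 3/2\<close>.\<close>
      show "\<forall>\<^sub>F N in sequentially. norm (- (real N powr (p - 1) / s N) * R N) \<le> (1 + p) * sqrt 2 * real N powr (p - 3/2)"
        using eventually_ge_at_top[of 2]
      proof eventually_elim
        case (elim N)
        have "norm (- (real N powr (p - 1) / s N) * R N) = (real N powr (p - 1) * R N) / s N"
          using s_nonneg \<mu> p by (simp add: abs_mult R_def)
        also have "\<dots> \<le> (real N powr (p - 1) * R N) / (\<mu> / sqrt (2 * real N))"
          using elim \<mu> p s_lower[OF elim] s_pos[OF elim]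
          by (intro divide_left_mono) (auto simp: R_def)
        also have "\<dots> = (1 + p) * sqrt 2 * (real N powr (p - 1) * sqrt (real N) / real N)"
          using \<mu> by (simp add: R_def real_sqrt_mult)
        also have "real N powr (p - 1) * sqrt (real N) / real N = real N powr (p - 1 + 1/2 - 1)"
          using elim by (simp only: powr_add powr_diff powr_half_sqrt) (simp add: powr_half_sqrt)
        finally show ?case by simp
      qed
      have "(\<lambda>N. real N powr (p - 3/2)) \<longlonglongrightarrow> 0"
        by (rule tendsto_neg_powr[OF _ filterlim_real_sequentially]) (use p in auto)
      then have "(\<lambda>N. (1 + p) * sqrt 2 * real N powr (p - 3/2)) \<longlonglongrightarrow> (1 + p) * sqrt 2 * 0"
        by (rule tendsto_mult_left)
      then show "(\<lambda>N. (1 + p) * sqrt 2 * real N powr (p - 3/2)) \<longlonglongrightarrow> 0" by simp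
    qed
  qed
  have char_Q: "(\<lambda>N. char (distr M borel (G'.Q N)) t) \<longlonglongrightarrow> char std_normal_distribution t" for t
    by (rule char_conv_of_moments[OF _ moments]) (simp add: G'.all_moments_Q)
  show "\<exists>s. s \<longlonglongrightarrow> 0 \<and> eventually (\<lambda>N. s N > 0) sequentially \<and>
      eventually (\<lambda>N. all_moments (\<lambda>\<omega>. (\<mu> - X N \<omega>) / s N)) sequentially \<and>
      eventually (\<lambda>N. expectation (\<lambda>\<omega>. ((\<mu> - X N \<omega>) / s N)\<^sup>2) \<le> 4) sequentially \<and>
      (\<forall>t. (\<lambda>N. char (distr M borel (\<lambda>\<omega>. (\<mu> - X N \<omega>) / s N)) t) \<longlonglongrightarrow> char std_normal_distribution t)"
  proof (intro exI[of _ s] conjI allI)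
    show "\<forall>\<^sub>F N in sequentially. s N > 0"
      using eventually_ge_at_top[of 2] by eventually_elim (rule s_pos)
    show "\<forall>\<^sub>F N in sequentially. all_moments (\<lambda>\<omega>. (\<mu> - X N \<omega>) / s N)"
      unfolding VQ by (intro always_eventually allI all_moments_intros G'.all_moments_Q)
    \<comment> \<open>Then \<open>(Q + e)^2 \<le> 2 Q^2 + 2\<close>, and unit variance of
      \<open>Q\<close> yields the bound 4.\<close>
    have "\<forall>\<^sub>F N in sequentially. \<bar>e N\<bar> < 1"
      using order_tendstoD(2)[OF tendsto_rabs[OF e_lim], of 1] by simp
    with eventually_ge_at_top[of 2]
    show "\<forall>\<^sub>F N in sequentially. expectation (\<lambda>\<omega>. ((\<mu> - X N \<omega>) / s N)\<^sup>2) \<le> 4"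
    proof eventually_elim
      case (elim N)
      have "expectation (\<lambda>\<omega>. ((\<mu> - X N \<omega>) / s N)\<^sup>2) \<le> expectation (\<lambda>\<omega>. 2 * G'.Q N \<omega> ^ 2 + 2)"
        unfolding VQ e_def[symmetric]
      proof (rule integral_mono)
        show "(G'.Q N \<omega> + e N)\<^sup>2 \<le> 2 * G'.Q N \<omega> ^ 2 + 2" for \<omega>
        proof -
          have "(e N)\<^sup>2 \<le> 1" using elim by (simp add: abs_square_le_1)
          then show ?thesis
            using sum_squares_bound[of "G'.Q N \<omega>" "e N"] by (simp add: power2_sum)
        qed
      qed (auto intro!: all_moments_integrable all_moments_intros G'.all_moments_Q)
      also have "\<dots> = 2 * expectation (\<lambda>\<omega>. G'.Q N \<omega> ^ 2) + 2"
        by (subst Bochner_Integration.integral_add)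
           (auto intro!: all_moments_integrable all_moments_intros G'.all_moments_Q simp: prob_space)
      also have "\<dots> = 4"
        using unit[of N] elim unfolding G'.expectation_Q_power_2 G'.\<tau>_0 by (simp add: f_def)
      finally show ?case .
    qed
    show "(\<lambda>N. char (distr M borel (\<lambda>\<omega>. (\<mu> - X N \<omega>) / s N)) t) \<longlonglongrightarrow> char std_normal_distribution t" for t
    proof -
      have "(\<lambda>N. iexp (t * e N) * char (distr M borel (G'.Q N)) t) \<longlonglongrightarrow> iexp (t * 0) * char std_normal_distribution t"
        by (intro tendsto_intros e_lim char_Q)
      then show ?thesis
        unfolding VQ e_def[symmetric]
        by (simp add: char_distr_shift all_moments_measurable G'.all_moments_Q)
    qed
  qed (rule s_lim)
qed

subsection \<open>The estimator of the speed\<close>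

text \<open>\<open>W\<close> is linear only up to null sets, so the Gaussian space consists of
  finite combinations of the variables \<open>W f\<close>, not of values of \<open>W\<close> at
  combined integrands.\<close>

lemma gaussian_space_span:
  assumes "prob_space M" "jointly_centred_gaussian M I X"
  shows "gaussian_space M {\<lambda>\<omega>. \<Sum>j\<in>J. a j * X j \<omega> |J a. finite J \<and> J \<subseteq> I}"
proof -
  interpret prob_space M by fact
  show ?thesis
  proof unfold_locales
    fix Y Z e
    assume "Y \<in> {\<lambda>\<omega>. \<Sum>j\<in>J. a j * X j \<omega> |J a. finite J \<and> J \<subseteq> I}"
      and "Z \<in> {\<lambda>\<omega>. \<Sum>j\<in>J. a j * X j \<omega> |J a. finite J \<and> J \<subseteq> I}"
    then obtain J a K b where Y: "Y = (\<lambda>\<omega>. \<Sum>j\<in>J. a j * X j \<omega>)" and J: "finite J" "J \<subseteq> I"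
      and Z: "Z = (\<lambda>\<omega>. \<Sum>j\<in>K. b j * X j \<omega>)" and K: "finite K" "K \<subseteq> I"
      by auto
    define d where "d j = (if j \<in> J then a j else 0) + e * (if j \<in> K then b j else 0)" for j
    have "Y \<omega> + e * Z \<omega> = (\<Sum>j\<in>J \<union> K. d j * X j \<omega>)" for \<omega>
    proof -
      have "(\<Sum>j\<in>J. a j * X j \<omega>) = (\<Sum>j\<in>J \<union> K. (if j \<in> J then a j else 0) * X j \<omega>)"
        using J K by (intro sum.mono_neutral_cong_left) auto
      moreover have "(\<Sum>j\<in>K. b j * X j \<omega>) = (\<Sum>j\<in>J \<union> K. (if j \<in> K then b j else 0) * X j \<omega>)"
        using J K by (intro sum.mono_neutral_cong_left) auto
      ultimately show ?thesis
        by (simp add: Y Z d_def sum_distrib_left sum.distrib[symmetric] algebra_simps)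
    qed
    then show "(\<lambda>\<omega>. Y \<omega> + e * Z \<omega>) \<in> {\<lambda>\<omega>. \<Sum>j\<in>J. a j * X j \<omega> |J a. finite J \<and> J \<subseteq> I}"
      unfolding mem_Collect_eq using J K
      by (intro exI[of _ "J \<union> K"] exI[of _ d] conjI ext) simp_all
  next
    fix Y assume "Y \<in> {\<lambda>\<omega>. \<Sum>j\<in>J. a j * X j \<omega> |J a. finite J \<and> J \<subseteq> I}"
    then show "centred_gaussian M Y"
      using assms(2) by (auto simp: jointly_centred_gaussian_def)
  qed
qed

theorem theorem6:
  fixes M :: "'a measure"
    and W :: "(real \<times> real \<Rightarrow> real) \<Rightarrow> 'a \<Rightarrow> real"
    and u :: "real \<Rightarrow> real \<Rightarrow> 'a \<Rightarrow> real"
    and H c x :: real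
  assumes "prob_space M"
    and "1/2 \<le> H" and "H < 3/4"
    and "c > 0"
    and "fractional_white_noise M H W"
    and "mild_wave_solution M W c u"
  defines "c_hat \<equiv> \<lambda>N \<omega>. speed_estimator H N (\<lambda>i. u (real i / real N) x \<omega>)"
  shows "strongly_consistent M c_hat c \<and> asymptotically_normal M c_hat c"
proof -
  define V where "V = {\<lambda>\<omega>. \<Sum>f\<in>J. a f * W f \<omega> |J a. finite J \<and> J \<subseteq> noise_integrands H}"
  interpret gaussian_space M V
    unfolding V_def using assms(1,5) by (intro gaussian_space_span) (auto simp: fractional_white_noise_def)
  define p where "p = 2 * H"
  have p: "1 \<le> p" "p < 3/2" using assms(2,3) by (auto simp: p_def)
  define \<mu> where "\<mu> = 1 / (4 * c)"
  have \<mu>: "\<mu> > 0" using \<open>c > 0\<close> by (simp add: \<mu>_def)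
  have c_\<mu>: "c = 1 / (4 * \<mu>)" using \<open>c > 0\<close> by (simp add: \<mu>_def)

  \<comment> \<open>\<open>u\<close> is merely a version of the stochastic convolution. The Gaussian
    calculus is applied to \<open>U\<close>, and the two agree almost surely at all of the countably
    many observation times at once.\<close>
  define U where "U t \<omega> = 1 / (2 * c) * W (indicat_real (backward_cone c t x)) \<omega>" for t \<omega>
  define D where "D N i \<omega> = U (real (i + 1) / real N) \<omega> + (- 1) * U (real i / real N) \<omega>" for N i \<omega>
  have integrand: "indicat_real (backward_cone c t x) \<in> noise_integrands H" if "0 \<le> t" for t
    by (rule backward_cone_noise_integrand) (use assms that in auto)
  have U_V: "U t \<in> V" if "0 \<le> t" for t
    unfolding V_def using integrand[OF that]
    unfolding mem_Collect_eq
    by (intro exI[of _ "{indicat_real (backward_cone c t x)}"] exI[of _ "\<lambda>_. 1 / (2 * c)"] conjI ext)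
       (simp_all add: U_def)
  have D_V: "D N i \<in> V" for N i
    unfolding D_def by (intro lin U_V) auto
  have U_cov: "expectation (\<lambda>\<omega>. U s \<omega> * U t \<omega>) = \<mu> * wave_cov p s t" if "0 \<le> s" "0 \<le> t" for s t
  proof -
    have *: "expectation (\<lambda>\<omega>. U s \<omega> * U t \<omega>) = \<mu> * wave_cov p s t" if "0 \<le> s" "s \<le> t" for s t
    proof -
      have "expectation (\<lambda>\<omega>. U s \<omega> * U t \<omega>) = expectation (\<lambda>\<omega>. 1 / (4 * c\<^sup>2) *
          (W (indicat_real (backward_cone c s x)) \<omega> * W (indicat_real (backward_cone c t x)) \<omega>))"
        by (simp add: U_def power2_eq_square)
      also have "\<dots> = 1 / (4 * c\<^sup>2) * noise_cov H (indicat_real (backward_cone c s x)) (indicat_real (backward_cone c t x))"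
        using assms(5) integrand that by (subst integral_mult_right_zero) (simp add: fractional_white_noise_def)
      also have "\<dots> = 1 / (4 * c\<^sup>2) * (c * wave_cov p s t)"
        using noise_cov_backward_cone[OF assms(2,4) that] by (simp only: p_def)
      also have "\<dots> = \<mu> * wave_cov p s t"
        using \<open>c > 0\<close> by (simp add: \<mu>_def power2_eq_square)
      finally show ?thesis .
    qed
    show ?thesis
      using *[of s t] *[of t s] that by (cases "s \<le> t") (auto simp: wave_cov_commute[of p t s] mult.commute[of "U t _"])
  qed
  have D_cov: "expectation (\<lambda>\<omega>. D N i \<omega> * D N j \<omega>) = \<mu> * increment_cov p N i j" for N i j
  proof -
    let ?t = "\<lambda>i. real i / real N"
    have I: "integrable M (\<lambda>\<omega>. U (?t k) \<omega> * U (?t l) \<omega>)" for k l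
      by (intro all_moments_integrable all_moments_mult all_moments_V U_V) auto
    have "expectation (\<lambda>\<omega>. D N i \<omega> * D N j \<omega>) = expectation (\<lambda>\<omega>. U (?t (i + 1)) \<omega> * U (?t (j + 1)) \<omega> -
        U (?t i) \<omega> * U (?t (j + 1)) \<omega> - U (?t (i + 1)) \<omega> * U (?t j) \<omega> + U (?t i) \<omega> * U (?t j) \<omega>)"
      by (simp add: D_def algebra_simps)
    also have "\<dots> = \<mu> * wave_cov p (?t (i + 1)) (?t (j + 1)) - \<mu> * wave_cov p (?t i) (?t (j + 1)) -
        \<mu> * wave_cov p (?t (i + 1)) (?t j) + \<mu> * wave_cov p (?t i) (?t j)"
      using I by (simp only: Bochner_Integration.integral_add Bochner_Integration.integral_diff
          Bochner_Integration.integrable_diff U_cov of_nat_0_le_iff divide_nonneg_nonneg)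
    finally show ?thesis
      by (simp add: increment_cov_def algebra_simps)
  qed

  define X where "X N \<omega> = real N powr (p - 1) * (\<Sum>i<N. (D N i \<omega>)\<^sup>2)" for N \<omega>
  note limits = quadratic_variation_limits[OF D_V p \<mu> D_cov, folded X_def]
  have X_lim: "AE \<omega> in M. (\<lambda>N. X N \<omega>) \<longlonglongrightarrow> \<mu>"
    by (rule limits(1))
  obtain s where s_lim: "s \<longlonglongrightarrow> 0" and s_pos: "\<forall>\<^sub>F N in sequentially. s N > 0"
    and s_moments: "\<forall>\<^sub>F N in sequentially. all_moments (\<lambda>\<omega>. (\<mu> - X N \<omega>) / s N)"
    and s_var: "\<forall>\<^sub>F N in sequentially. expectation (\<lambda>\<omega>. ((\<mu> - X N \<omega>) / s N)\<^sup>2) \<le> 4"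
    and s_char: "\<And>t. (\<lambda>N. char (distr M borel (\<lambda>\<omega>. (\<mu> - X N \<omega>) / s N)) t) \<longlonglongrightarrow> char std_normal_distribution t"
    using limits(2) by blast
  have X_meas[measurable]: "X N \<in> borel_measurable M" for N
  proof -
    have [measurable]: "D N i \<in> borel_measurable M" for i
      using all_moments_V[OF D_V] all_moments_measurable by blast
    show ?thesis unfolding X_def by measurable
  qed

  have u_meas[measurable]: "u t x \<in> borel_measurable M" if "0 \<le> t" for t
    using assms(6) that by (auto simp: mild_wave_solution_def)
  have est_meas[measurable]: "c_hat N \<in> borel_measurable M" for N
    unfolding c_hat_def speed_estimator_def by measurable
  have "AE \<omega> in M. \<forall>N i. u (real i / real N) x \<omega> = U (real i / real N) \<omega>"
    unfolding AE_all_countable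
  proof (intro allI)
    fix N i :: nat
    have "0 \<le> real i / real N" by simp
    then show "AE \<omega> in M. u (real i / real N) x \<omega> = U (real i / real N) \<omega>"
      using assms(6) unfolding mild_wave_solution_def U_def by blast
  qed
  then have est_eq: "AE \<omega> in M. \<forall>N. c_hat N \<omega> = 1 / (4 * X N \<omega>)"
  proof eventually_elim
    case (elim \<omega>)
    then have "u (real i / real N) x \<omega> = U (real i / real N) \<omega>" for N i
      by blast
    then show ?case
      by (simp only: c_hat_def speed_estimator_def X_def D_def p_def) simp
  qed

  have "AE \<omega> in M. (\<lambda>N. c_hat N \<omega>) \<longlonglongrightarrow> c"
    using est_eq X_lim
  proof eventually_elim
    case (elim \<omega>)
    have "(\<lambda>N. 1 / (4 * X N \<omega>)) \<longlonglongrightarrow> 1 / (4 * \<mu>)"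
      using \<mu> elim by (intro tendsto_intros) auto
    then show ?case
      using elim by (simp add: c_\<mu>)
  qed
  then have consistent: "strongly_consistent M c_hat c"
    using est_meas by (simp add: strongly_consistent_def)

  \<comment> \<open>The delta method: \<open>z \<mapsto> 1 / (4 z)\<close> has derivative
    \<open>- 1 / (4 \<mu>^2)\<close> at \<open>\<mu>\<close>, so this scaling makes the limit
    standard normal.\<close>
  define a where "a N = 4 * \<mu>\<^sup>2 / s N" for N
  have a_lim: "filterlim a at_top sequentially"
    unfolding a_def divide_inverse
    by (rule filterlim_tendsto_pos_mult_at_top[OF tendsto_const _ filterlim_inverse_at_top[OF s_lim s_pos]])
       (use \<mu> in simp)
  text \<open>If \<open>X N \<omega> = 0\<close>, the estimator is \<open>0\<close> by convention and the factor \<open>-1\<close> restores the identity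
    \<open>a N * (c_hat N \<omega> - c) = B N \<omega> * ((\<mu> - X N \<omega>) / s N)\<close>.\<close>
  define B where "B N \<omega> = (if X N \<omega> = 0 then - 1 else \<mu> / X N \<omega>)" for N \<omega>
  have B_meas[measurable]: "B N \<in> borel_measurable M" for N
    unfolding B_def by measurable
  have B_lim: "AE \<omega> in M. (\<lambda>N. B N \<omega>) \<longlonglongrightarrow> 1"
    using X_lim
  proof eventually_elim
    case (elim \<omega>)
    have "(\<lambda>N. \<mu> / X N \<omega>) \<longlonglongrightarrow> \<mu> / \<mu>"
      using \<mu> elim by (intro tendsto_intros) auto
    moreover have "\<forall>\<^sub>F N in sequentially. \<mu> / X N \<omega> = B N \<omega>"
      using tendsto_imp_eventually_ne[OF elim, of 0] \<mu> by (auto simp: B_def elim: eventually_mono)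
    ultimately show ?case
      using \<mu> Lim_transform_eventually by fastforce
  qed
  have a_est: "a N * (1 / (4 * X N \<omega>) - c) = B N \<omega> * ((\<mu> - X N \<omega>) / s N)" for N \<omega>
    using \<mu> by (cases "X N \<omega> = 0"; cases "s N = 0") (simp_all add: a_def B_def c_\<mu> divide_simps power2_eq_square)
  have distr_eq: "distr M borel (\<lambda>\<omega>. a N * (c_hat N \<omega> - c)) = distr M borel (\<lambda>\<omega>. B N \<omega> * ((\<mu> - X N \<omega>) / s N))" for N
  proof (rule distr_cong_AE)
    show "AE \<omega> in M. a N * (c_hat N \<omega> - c) = B N \<omega> * ((\<mu> - X N \<omega>) / s N)"
      using est_eq by eventually_elim (simp add: a_est del: times_divide_eq_right)
  qed auto
  have "weak_conv_m (\<lambda>N. distr M borel (\<lambda>\<omega>. a N * (c_hat N \<omega> - c))) std_normal_distribution"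
  proof (rule levy_continuity)
    show "real_distribution (distr M borel (\<lambda>\<omega>. a N * (c_hat N \<omega> - c)))" for N
      by (rule real_distribution_distr) measurable
    show "(\<lambda>N. char (distr M borel (\<lambda>\<omega>. a N * (c_hat N \<omega> - c))) t) \<longlonglongrightarrow> char std_normal_distribution t" for t
      unfolding distr_eq
      by (rule char_conv_slutsky[OF s_moments s_var B_meas B_lim s_char])
  qed (rule real_dist_normal_dist)
  then have "asymptotically_normal M c_hat c"
    unfolding asymptotically_normal_def using est_meas a_lim
    by (intro conjI allI exI[of _ a] exI[of _ 0] exI[of _ 1]) auto
  with consistent show ?thesis by blast
qed

end
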